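(* Let $\Gamma_{G_{2,1}}$ be any finite generating set of the Thompson group $G_{2,1}$. Let $f:\{0,1\}^m\to\{0,1\}^n$ be any total function and let $C_f$ be a minimum-size circuit (made of $\wedge,\vee,\neg$, fork-gates and wire-swappings $\tau_{i,j}$) that computes $f$. Then there exists a word $W_f$ over the generating set $\Gamma_{G_{2,1}}\cup\{\tau_{i,i+1}:1\le i\}$ of $G_{2,1}$ such that: (1) For all $x\in\{0,1\}^m$: $w_f(0\,x)=0\,f(x)\,x$ (concatenation of words), where $w_f$ is the element of $G_{2,1}$ represented by $W_f$. (2) The length of the word $W_f$ is bounded by $|W_f|\le O(|C_f|^4)$ (with an implied constant not depending on $f,m,n$). (3) The largest subscript of any transposition $\tau_{i,i+1}$ occurring in $W_f$ is $\le|C_f|^2+2$.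
   Context: Thompson group. Let $\{0,1\}^*$ be the set of finite bitstrings. A right ideal is a set $R\subseteq\{0,1\}^*$ with $R\{0,1\}^*\subseteq R$; it is essential if it meets every (non-empty) right ideal. An isomorphism between right ideals $R_1,R_2$ is a bijection $\varphi:R_1\to R_2$ with $\varphi(rz)=\varphi(r)z$ for all $r\in R_1,z\in\{0,1\}^*$. Every isomorphism $\varphi$ between essential right ideals has a unique maximal extension $\max(\varphi)$ among isomorphisms between essential right ideals. $G_{2,1}$ is the group of all maximally extended isomorphisms between finitely generated essential right ideals of $\{0,1\}^*$, with product $\varphi\cdot\psi=\max(\varphi\circ\psi)$; it acts partially on $\{0,1\}^*$ on the left. The bit transposition $\tau_{i,j}\in G_{2,1}$ ($1\le i<j$) is $ux_ivx_jw\mapsto ux_jvx_iw$, where $|u|=i-1$, $|v|=j-i-1$, $x_i,x_j\in\{0,1\}$, $w\in\{0,1\}^*$. Circuits. A circuit computing $f:\{0,1\}^m\to\{0,1\}^n$ is an acyclic boolean circuit with $m$ input ports and $n$ output ports made from gates $\wedge$ (and), $\vee$ (or), $\neg$ (not), fork: $x\mapsto(x,x)$, each applicable to any wires, and wire-swappings $\tau_{i,j}$ exchanging the $i$th and $j$th wires. The size $|C|$ of a circuit $C$ is the number of its gates, including forks and wire-swappings, as well as the input ports and the output ports. $|W|$ denotes the length of a word $W$. *)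

theory Defs
  imports "HOL-Algebra.Generated_Groups"
begin

type_synonym bits = "bool list"

definition right_ideal :: "bits set \<Rightarrow> bool" where
  "right_ideal R \<longleftrightarrow> (\<forall>r\<in>R. \<forall>z. r @ z \<in> R)"

definition essential_right_ideal :: "bits set \<Rightarrow> bool" where
  "essential_right_ideal R \<longleftrightarrow>
     right_ideal R \<and> (\<forall>J. right_ideal J \<and> J \<noteq> {} \<longrightarrow> R \<inter> J \<noteq> {})"

definition fin_gen :: "bits set \<Rightarrow> bool" where
  "fin_gen R \<longleftrightarrow> (\<exists>B. finite B \<and> R = {b @ z | b z. b \<in> B})"

definition right_ideal_iso :: "bits set \<Rightarrow> bits set \<Rightarrow> (bits \<rightharpoonup> bits) \<Rightarrow> bool" where
  "right_ideal_iso R1 R2 \<phi> \<longleftrightarrow>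
     right_ideal R1 \<and> right_ideal R2 \<and> dom \<phi> = R1 \<and>
     bij_betw (\<lambda>r. the (\<phi> r)) R1 R2 \<and>
     (\<forall>r\<in>R1. \<forall>z. \<phi> (r @ z) = Some (the (\<phi> r) @ z))"

definition essential_iso :: "(bits \<rightharpoonup> bits) \<Rightarrow> bool" where
  "essential_iso \<phi> \<longleftrightarrow>
     (\<exists>R1 R2. essential_right_ideal R1 \<and> essential_right_ideal R2 \<and>
              right_ideal_iso R1 R2 \<phi>)"

definition fin_gen_essential_iso :: "(bits \<rightharpoonup> bits) \<Rightarrow> bool" where
  "fin_gen_essential_iso \<phi> \<longleftrightarrow>
     (\<exists>R1 R2. essential_right_ideal R1 \<and> essential_right_ideal R2 \<and>
              fin_gen R1 \<and> fin_gen R2 \<and> right_ideal_iso R1 R2 \<phi>)"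

definition max_ext :: "(bits \<rightharpoonup> bits) \<Rightarrow> (bits \<rightharpoonup> bits)" where
  "max_ext \<phi> = (THE \<psi>. essential_iso \<psi> \<and> \<phi> \<subseteq>\<^sub>m \<psi> \<and>
                   (\<forall>\<chi>. essential_iso \<chi> \<and> \<psi> \<subseteq>\<^sub>m \<chi> \<longrightarrow> \<chi> = \<psi>))"

definition G21 :: "(bits \<rightharpoonup> bits) monoid" where
  "G21 = \<lparr>carrier = {\<phi>. fin_gen_essential_iso \<phi> \<and> max_ext \<phi> = \<phi>},
          mult = (\<lambda>\<phi> \<psi>. max_ext (\<phi> \<circ>\<^sub>m \<psi>)),
          one = Some\<rparr>"

text \<open>Positions are counted from 1, list indices from 0.\<close>

definition tau :: "nat \<Rightarrow> nat \<Rightarrow> (bits \<rightharpoonup> bits)" where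
  "tau i j = (\<lambda>s. if 1 \<le> i \<and> i < j \<and> j \<le> length s
                  then Some (s[i - 1 := s ! (j - 1), j - 1 := s ! (i - 1)])
                  else None)"

text \<open>
  Words are formal: the letter \<open>Tau i\<close> stands for the transposition of positions
  \<open>i\<close> and \<open>i + 1\<close> and is kept apart from the letters coming from the finite generating
  set \<open>\<Gamma>\<close>, even if \<open>\<Gamma>\<close> happens to contain that transposition.
  As usual for group words, formal inverses of the letters in \<open>\<Gamma>\<close> are allowed
  and have length 1; the transpositions are their own inverses.
\<close>

datatype letter = Gen "bits \<rightharpoonup> bits" | GenInv "bits \<rightharpoonup> bits" | Tau nat

fun letter_over :: "(bits \<rightharpoonup> bits) set \<Rightarrow> letter \<Rightarrow> bool" where
  "letter_over \<Gamma> (Gen g) \<longleftrightarrow> g \<in> \<Gamma>"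
| "letter_over \<Gamma> (GenInv g) \<longleftrightarrow> g \<in> \<Gamma>"
| "letter_over \<Gamma> (Tau i) \<longleftrightarrow> 1 \<le> i"

fun letter_val :: "letter \<Rightarrow> (bits \<rightharpoonup> bits)" where
  "letter_val (Gen g) = g"
| "letter_val (GenInv g) = inv\<^bsub>G21\<^esub> g"
| "letter_val (Tau i) = tau i (i + 1)"

definition word_val :: "letter list \<Rightarrow> (bits \<rightharpoonup> bits)" where
  "word_val W = foldr (\<lambda>l g. letter_val l \<otimes>\<^bsub>G21\<^esub> g) W \<one>\<^bsub>G21\<^esub>"

text \<open>
  A circuit is given as a netlist: its wires are named by natural numbers, and each gate
  lists first its input wires and then its output wires. Fan-out is explicit (fork gates),
  so every wire has exactly one source, which is an input port or a gate output, and
  is consumed by at most one gate input or output port; a wire may be left unused.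
  A gate can be attached to any wires, so \<open>Swap i j k l\<close>, which puts the value of
  wire \<open>j\<close> on wire \<open>k\<close> and that of wire \<open>i\<close> on wire \<open>l\<close>, is the
  wire-swapping of the wires \<open>i\<close> and \<open>j\<close>, continued as \<open>k\<close> and \<open>l\<close>.
\<close>

datatype gate =
    And nat nat nat
  | Or nat nat nat
  | Not nat nat
  | Fork nat nat nat
  | Swap nat nat nat nat

fun gate_ins :: "gate \<Rightarrow> nat list" where
  "gate_ins (And i j k) = [i, j]"
| "gate_ins (Or i j k) = [i, j]"
| "gate_ins (Not i k) = [i]"
| "gate_ins (Fork i k l) = [i]"
| "gate_ins (Swap i j k l) = [i, j]"

fun gate_outs :: "gate \<Rightarrow> nat list" where
  "gate_outs (And i j k) = [k]"
| "gate_outs (Or i j k) = [k]"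
| "gate_outs (Not i k) = [k]"
| "gate_outs (Fork i k l) = [k, l]"
| "gate_outs (Swap i j k l) = [k, l]"

fun gate_holds :: "(nat \<Rightarrow> bool) \<Rightarrow> gate \<Rightarrow> bool" where
  "gate_holds v (And i j k) \<longleftrightarrow> v k = (v i \<and> v j)"
| "gate_holds v (Or i j k) \<longleftrightarrow> v k = (v i \<or> v j)"
| "gate_holds v (Not i k) \<longleftrightarrow> v k = (\<not> v i)"
| "gate_holds v (Fork i k l) \<longleftrightarrow> v k = v i \<and> v l = v i"
| "gate_holds v (Swap i j k l) \<longleftrightarrow> v k = v j \<and> v l = v i"

record circuit =
  in_wires :: "nat list"
  gates :: "gate list"
  out_wires :: "nat list"

definition circuit_sources :: "circuit \<Rightarrow> nat list" where
  "circuit_sources C = in_wires C @ concat (map gate_outs (gates C))"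

definition circuit_sinks :: "circuit \<Rightarrow> nat list" where
  "circuit_sinks C = concat (map gate_ins (gates C)) @ out_wires C"

definition well_formed :: "circuit \<Rightarrow> bool" where
  "well_formed C \<longleftrightarrow>
     distinct (circuit_sources C) \<and> distinct (circuit_sinks C) \<and>
     set (circuit_sinks C) \<subseteq> set (circuit_sources C) \<and>
     acyclic {(a, b). \<exists>g\<in>set (gates C). a \<in> set (gate_ins g) \<and> b \<in> set (gate_outs g)}"

text \<open>
  By acyclicity, the input values determine the values of all wires of a well-formed
  circuit, so the valuation \<open>v\<close> below always exists and is unique on these wires.
\<close>

definition computes :: "circuit \<Rightarrow> nat \<Rightarrow> nat \<Rightarrow> (bits \<Rightarrow> bits) \<Rightarrow> bool" where
  "computes C m n f \<longleftrightarrow>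
     well_formed C \<and> length (in_wires C) = m \<and> length (out_wires C) = n \<and>
     (\<forall>x. length x = m \<longrightarrow>
        (\<exists>v. (\<forall>g\<in>set (gates C). gate_holds v g) \<and>
             map v (in_wires C) = x \<and> map v (out_wires C) = f x))"

definition circuit_size :: "circuit \<Rightarrow> nat" where
  "circuit_size C = length (in_wires C) + length (gates C) + length (out_wires C)"

definition min_circuit :: "circuit \<Rightarrow> nat \<Rightarrow> nat \<Rightarrow> (bits \<Rightarrow> bits) \<Rightarrow> bool" where
  "min_circuit C m n f \<longleftrightarrow>
     computes C m n f \<and> (\<forall>C'. computes C' m n f \<longrightarrow> circuit_size C \<le> circuit_size C')"

end

theory Submission
  imports Defs "HOL-Combinatorics.Transposition"
begin

text \<open>
  A right ideal is essential and finitely generated iff it contains all sufficiently long words,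
  so the maximal extension of an isomorphism can be written down explicitly and a product in
  \<open>G\<^bsub>2,1\<^esub>\<close> extends the composition of partial maps. The element
  \<open>0 \<mapsto> 00, 10 \<mapsto> 01, 11 \<mapsto> 1\<close> creates as many zeros as needed behind the
  leading \<open>0\<close>. On words of the resulting fixed length a gate acts reversibly, by
  \<open>(b\<^sub>1, b\<^sub>2, b\<^sub>3) \<mapsto> (b\<^sub>1, b\<^sub>2, b\<^sub>3 xor h(b\<^sub>1, b\<^sub>2))\<close> on three bits,
  which is a fixed element of the group conjugated by position transpositions. Computing all
  wires into zeros, copying the output, uncomputing, and deleting the remaining zeros with the
  inverse of the padding element gives \<open>0 f(x) x\<close>. One extra bit per gate suffices,
  so subscripts are at most \<open>|C| + 1\<close> and the length is \<open>O(|C|\<^sup>2)\<close>.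
\<close>

section \<open>The group structure\<close>

lemma right_idealD: "right_ideal R \<Longrightarrow> r \<in> R \<Longrightarrow> r @ z \<in> R"
  by (simp add: right_ideal_def)

text \<open>The right ideal generated by \<open>s\<close> meets \<open>R\<close>, so
  \<open>s\<close> and some generator in \<open>B\<close> have a common extension. If
  \<open>s\<close> is at least as long as every generator, that generator is a prefix of
  \<open>s\<close>.\<close>

lemma essential_fin_gen_imp_long:
  assumes "essential_right_ideal R" "fin_gen R"
  shows "\<exists>N. \<forall>s. N \<le> length s \<longrightarrow> s \<in> R"
proof -
  obtain B where B: "finite B" "R = {b @ z | b z. b \<in> B}"
    using assms(2) by (auto simp: fin_gen_def)
  \<comment> \<open>\<open>insert 0\<close> keeps \<open>Max\<close> meaningful for an empty
    \<open>B\<close>.\<close>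
  have "s \<in> R" if s: "Max (insert 0 (length ` B)) \<le> length s" for s
  proof -
    have "right_ideal {s @ z | z. True}"
      by (auto simp: right_ideal_def)
    then have "R \<inter> {s @ z | z. True} \<noteq> {}"
      using assms(1) by (auto simp: essential_right_ideal_def)
    then obtain z b y where b: "b \<in> B" "s @ z = b @ y"
      using B(2) by auto
    then have "length b \<le> Max (insert 0 (length ` B))"
      using B(1) by simp
    then have "length b \<le> length s"
      using s by simp
    then have "s = b @ drop (length b) s"
      using b(2) by (metis append_eq_append_conv_if append_take_drop_id)
    then show ?thesis
      using B(2) b(1) by blast
  qed
  then show ?thesis by blast
qed

text \<open>Padding any member of \<open>J\<close> with \<open>N\<close> zeros stays in
  \<open>J\<close> and reaches \<open>R\<close>.\<close>

lemma long_imp_essential: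
  assumes "right_ideal R" "\<And>s. N \<le> length s \<Longrightarrow> s \<in> R"
  shows "essential_right_ideal R"
  unfolding essential_right_ideal_def
proof (intro conjI allI impI)
  fix J :: "bits set"
  assume J: "right_ideal J \<and> J \<noteq> {}"
  then obtain s where "s \<in> J" by blast
  then have "s @ replicate N False \<in> J"
    using J right_idealD by blast
  moreover have "s @ replicate N False \<in> R"
    by (rule assms(2)) simp
  ultimately show "R \<inter> J \<noteq> {}" by blast
qed (rule assms(1))

text \<open>The members of length at most \<open>N\<close> generate: a longer one extends its own
  prefix of length \<open>N\<close>, which lies in \<open>R\<close> by the length
  hypothesis.\<close>

lemma long_imp_fin_gen:
  assumes "right_ideal R" "\<And>s. N \<le> length s \<Longrightarrow> s \<in> R"
  shows "fin_gen R"
  unfolding fin_gen_def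
proof (intro exI conjI)
  have "finite {s :: bits. set s \<subseteq> UNIV \<and> length s \<le> N}"
    by (rule finite_lists_length_le) simp
  then show "finite {s \<in> R. length s \<le> N}"
    by (rule rev_finite_subset) auto
  show "R = {b @ z |b z. b \<in> {s \<in> R. length s \<le> N}}"
  proof (intro Set.set_eqI iffI)
    fix s assume s: "s \<in> R"
    show "s \<in> {b @ z |b z. b \<in> {s \<in> R. length s \<le> N}}"
    proof (cases "length s \<le> N")
      case True
      then show ?thesis using s by (intro CollectI exI[of _ s] exI[of _ "[]"]) auto
    next
      case False
      then have "take N s \<in> {s \<in> R. length s \<le> N}"
        using assms(2) by simp
      then show ?thesis
        by (intro CollectI exI[of _ "take N s"] exI[of _ "drop N s"]) auto
    qed
  qed (use assms(1) right_idealD in blast)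
qed

section \<open>Isomorphisms as equivariant partial maps\<close>

definition equivariant :: "(bits \<rightharpoonup> bits) \<Rightarrow> bool" where
  "equivariant \<phi> \<longleftrightarrow> (\<forall>r t z. \<phi> r = Some t \<longrightarrow> \<phi> (r @ z) = Some (t @ z))"

lemma equivariantD: "equivariant \<phi> \<Longrightarrow> \<phi> r = Some t \<Longrightarrow> \<phi> (r @ z) = Some (t @ z)"
  by (simp add: equivariant_def)

text \<open>Working form of \<open>fin_gen_essential_iso\<close> that names no ideals: the single
  bound \<open>N\<close> encodes that domain and range are both essential and finitely
  generated.\<close>

definition cofinite_iso :: "(bits \<rightharpoonup> bits) \<Rightarrow> bool" where
  "cofinite_iso \<phi> \<longleftrightarrow> equivariant \<phi> \<and>
     (\<forall>r s t. \<phi> r = Some t \<longrightarrow> \<phi> s = Some t \<longrightarrow> r = s) \<and>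
     (\<exists>N. \<forall>s. N \<le> length s \<longrightarrow> s \<in> dom \<phi> \<and> s \<in> ran \<phi>)"

lemma cofinite_isoI:
  assumes "\<And>r t z. \<phi> r = Some t \<Longrightarrow> \<phi> (r @ z) = Some (t @ z)"
    and "\<And>r s t. \<phi> r = Some t \<Longrightarrow> \<phi> s = Some t \<Longrightarrow> r = s"
    and "\<And>s. N \<le> length s \<Longrightarrow> \<exists>t. \<phi> s = Some t"
    and "\<And>s. N \<le> length s \<Longrightarrow> \<exists>r. \<phi> r = Some s"
  shows "cofinite_iso \<phi>"
  unfolding cofinite_iso_def equivariant_def dom_def ran_def
  using assms by (intro conjI exI[of _ N]) (blast | simp)+

lemma
  assumes "cofinite_iso \<phi>"
  shows cofinite_iso_equivariant: "equivariant \<phi>"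
    and cofinite_iso_inj: "\<phi> r = Some t \<Longrightarrow> \<phi> s = Some t \<Longrightarrow> r = s"
  using assms by (auto simp: cofinite_iso_def)

lemma cofinite_iso_long:
  assumes "cofinite_iso \<phi>"
  obtains N where "\<And>s. N \<le> length s \<Longrightarrow> \<exists>t. \<phi> s = Some t"
    "\<And>s. N \<le> length s \<Longrightarrow> \<exists>r. \<phi> r = Some s"
  using assms unfolding cofinite_iso_def dom_def ran_def by blast

lemma right_ideal_iso_equivariant:
  assumes "right_ideal_iso R1 R2 \<phi>"
  shows "equivariant \<phi>"
  using assms unfolding right_ideal_iso_def equivariant_def
  by (metis domI option.sel)

lemma equivariant_inj_right_ideal_iso:
  assumes "equivariant \<phi>" "\<And>r s t. \<phi> r = Some t \<Longrightarrow> \<phi> s = Some t \<Longrightarrow> r = s"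
  shows "right_ideal_iso (dom \<phi>) (ran \<phi>) \<phi>"
  unfolding right_ideal_iso_def
proof (intro conjI ballI allI)
  show "right_ideal (dom \<phi>)" "right_ideal (ran \<phi>)"
    using assms(1) unfolding right_ideal_def equivariant_def dom_def ran_def by blast+
  show "bij_betw (\<lambda>r. the (\<phi> r)) (dom \<phi>) (ran \<phi>)"
    unfolding bij_betw_def inj_on_def
  proof (intro conjI ballI impI)
    show "(\<lambda>r. the (\<phi> r)) ` dom \<phi> = ran \<phi>"
      by (force simp: ran_def dom_def)
  qed (metis assms(2) domD option.sel)
qed (use assms(1) in \<open>auto simp: equivariant_def\<close>)

lemma fin_gen_essential_iso_iff: "fin_gen_essential_iso \<phi> \<longleftrightarrow> cofinite_iso \<phi>"
proof
  assume "fin_gen_essential_iso \<phi>"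
  then obtain R1 R2 where R: "essential_right_ideal R1" "essential_right_ideal R2"
    "fin_gen R1" "fin_gen R2" "right_ideal_iso R1 R2 \<phi>"
    by (auto simp: fin_gen_essential_iso_def)
  obtain N1 where N1: "\<And>s. N1 \<le> length s \<Longrightarrow> s \<in> R1"
    using essential_fin_gen_imp_long R by metis
  obtain N2 where N2: "\<And>s. N2 \<le> length s \<Longrightarrow> s \<in> R2"
    using essential_fin_gen_imp_long R by metis
  have dom: "dom \<phi> = R1" and bij: "bij_betw (\<lambda>r. the (\<phi> r)) R1 R2"
    using R(5) by (auto simp: right_ideal_iso_def)
  show "cofinite_iso \<phi>"
  proof (rule cofinite_isoI[of _ "max N1 N2"])
    show "\<phi> (r @ z) = Some (t @ z)" if "\<phi> r = Some t" for r t z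
      using right_ideal_iso_equivariant[OF R(5)] that by (rule equivariantD)
    show "r = s" if "\<phi> r = Some t" "\<phi> s = Some t" for r s t
      using bij that dom unfolding bij_betw_def inj_on_def by (metis domI)
    show "\<exists>t. \<phi> s = Some t" if "max N1 N2 \<le> length s" for s
      using N1[of s] that dom by auto
    show "\<exists>r. \<phi> r = Some s" if "max N1 N2 \<le> length s" for s
    proof -
      have "s \<in> (\<lambda>r. the (\<phi> r)) ` R1"
        using N2[of s] that bij by (simp add: bij_betw_def)
      then show ?thesis using dom by force
    qed
  qed
next
  assume iso: "cofinite_iso \<phi>"
  obtain N where N: "\<And>s. N \<le> length s \<Longrightarrow> s \<in> dom \<phi>" "\<And>s. N \<le> length s \<Longrightarrow> s \<in> ran \<phi>"
    using iso unfolding cofinite_iso_def by blast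
  have "right_ideal_iso (dom \<phi>) (ran \<phi>) \<phi>"
    using equivariant_inj_right_ideal_iso iso by (auto simp: cofinite_iso_def)
  moreover from this have "right_ideal (dom \<phi>)" "right_ideal (ran \<phi>)"
    by (simp_all add: right_ideal_iso_def)
  ultimately show "fin_gen_essential_iso \<phi>"
    unfolding fin_gen_essential_iso_def
    using long_imp_essential[OF _ N(1)] long_imp_essential[OF _ N(2)]
      long_imp_fin_gen[OF _ N(1)] long_imp_fin_gen[OF _ N(2)] by blast
qed

text \<open>The maximal extension takes \<open>s\<close> to \<open>t\<close> as soon as
  \<open>\<phi>\<close> takes \<open>s @ z\<close> to \<open>t @ z\<close> wherever it is defined.\<close>

definition closure_map :: "(bits \<rightharpoonup> bits) \<Rightarrow> (bits \<rightharpoonup> bits)" where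
  "closure_map \<phi> s =
     (let P = (\<lambda>t. \<forall>z. s @ z \<in> dom \<phi> \<longrightarrow> \<phi> (s @ z) = Some (t @ z))
      in if Ex P then Some (Eps P) else None)"

text \<open>Eliminates the choice operator: two candidate values agree after appending
  \<open>N\<close> zeros, where \<phi> is defined, and the common suffix cancels.\<close>

lemma closure_map_iff:
  assumes "cofinite_iso \<phi>"
  shows "closure_map \<phi> s = Some t \<longleftrightarrow> (\<forall>z. s @ z \<in> dom \<phi> \<longrightarrow> \<phi> (s @ z) = Some (t @ z))"
proof -
  let ?P = "\<lambda>t. \<forall>z. s @ z \<in> dom \<phi> \<longrightarrow> \<phi> (s @ z) = Some (t @ z)"
  obtain N where N: "\<And>s. N \<le> length s \<Longrightarrow> \<exists>t. \<phi> s = Some t"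
    using cofinite_iso_long[OF assms] by blast
  have uniq: "t1 = t2" if "?P t1" "?P t2" for t1 t2
  proof -
    have "s @ replicate N False \<in> dom \<phi>"
      using N[of "s @ replicate N False"] by auto
    then have "t1 @ replicate N False = t2 @ replicate N False"
      using that by (metis option.inject)
    then show ?thesis by simp
  qed
  have eq: "closure_map \<phi> s = (if Ex ?P then Some (Eps ?P) else None)"
    unfolding closure_map_def Let_def ..
  show ?thesis
  proof
    assume *: "closure_map \<phi> s = Some t"
    show "?P t"
    proof (cases "Ex ?P")
      case True
      then have "Eps ?P = t" using * eq by (simp only: if_True option.inject)
      then show ?thesis using someI_ex[OF True] by (simp only:)
    next
      case False
      then show ?thesis using * eq by (simp only: if_False option.distinct)
    qed
  next
    assume t: "?P t"
    have "Eps ?P = t" by (rule some_equality[where P = ?P, OF t]) (erule uniq[OF _ t])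
    moreover have "Ex ?P" using t by (rule exI)
    ultimately show "closure_map \<phi> s = Some t"
      using eq by (simp only: if_True)
  qed
qed

lemma closure_map_extends:
  assumes "cofinite_iso \<phi>" "\<phi> s = Some t"
  shows "closure_map \<phi> s = Some t"
  using assms by (simp add: closure_map_iff equivariantD cofinite_iso_equivariant)

lemma cofinite_iso_closure_map:
  assumes "cofinite_iso \<phi>"
  shows "cofinite_iso (closure_map \<phi>)"
proof -
  obtain N where N: "\<And>s. N \<le> length s \<Longrightarrow> \<exists>t. \<phi> s = Some t"
    "\<And>s. N \<le> length s \<Longrightarrow> \<exists>r. \<phi> r = Some s"
    using cofinite_iso_long[OF assms] by blast
  show ?thesis
  proof (rule cofinite_isoI[of _ N])
    show "closure_map \<phi> (r @ z) = Some (t @ z)" if "closure_map \<phi> r = Some t" for r t z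
      using that by (simp add: closure_map_iff[OF assms])
    show "r = s" if rs: "closure_map \<phi> r = Some t" "closure_map \<phi> s = Some t" for r s t
    proof -
      \<comment> \<open>The padding moves both words into the domain of \<phi>, whose injectivity
        then applies.\<close>
      let ?z = "replicate N False"
      have "r @ ?z \<in> dom \<phi>" "s @ ?z \<in> dom \<phi>"
        using N(1)[of "r @ ?z"] N(1)[of "s @ ?z"] by auto
      then have "\<phi> (r @ ?z) = Some (t @ ?z)" "\<phi> (s @ ?z) = Some (t @ ?z)"
        using rs by (simp_all add: closure_map_iff[OF assms])
      then show ?thesis using cofinite_iso_inj[OF assms] by blast
    qed
  qed (use N closure_map_extends[OF assms] in blast)+
qed

text \<open>If \<chi> sends \<open>s\<close> to \<open>t\<close>, equivariance fixes its values on
  all extensions of \<open>s\<close>, and \<phi> has to agree with them on its domain. This is the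
  criterion of \<open>closure_map_iff\<close>.\<close>

lemma closure_map_maximal:
  assumes "cofinite_iso \<phi>" "equivariant \<chi>" "\<phi> \<subseteq>\<^sub>m \<chi>"
  shows "\<chi> \<subseteq>\<^sub>m closure_map \<phi>"
  unfolding map_le_def
proof
  fix s assume "s \<in> dom \<chi>"
  then obtain t where t: "\<chi> s = Some t" by blast
  have "\<phi> (s @ z) = Some (t @ z)" if "s @ z \<in> dom \<phi>" for z
    using assms(3) that equivariantD[OF assms(2) t] by (auto simp: map_le_def)
  then show "\<chi> s = closure_map \<phi> s"
    using t closure_map_iff[OF assms(1)] by metis
qed

lemma map_le_closure_map: "cofinite_iso \<phi> \<Longrightarrow> \<phi> \<subseteq>\<^sub>m closure_map \<phi>"
  by (auto simp: map_le_def closure_map_extends)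

text \<open>The closure is the greatest essential isomorphism above \<phi>, hence the only maximal
  one, which is what the definite description in \<open>max_ext\<close> asks for.\<close>

lemma max_ext_eq_closure_map:
  assumes "cofinite_iso \<phi>"
  shows "max_ext \<phi> = closure_map \<phi>"
  unfolding max_ext_def
proof (rule the_equality)
  have equi: "equivariant \<chi>" if "essential_iso \<chi>" for \<chi>
    using that right_ideal_iso_equivariant by (auto simp: essential_iso_def)
  have "essential_iso (closure_map \<phi>)"
    using cofinite_iso_closure_map[OF assms]
    unfolding fin_gen_essential_iso_iff[symmetric] fin_gen_essential_iso_def essential_iso_def
    by blast
  moreover have max: "\<chi> \<subseteq>\<^sub>m closure_map \<phi>" if "essential_iso \<chi>" "\<phi> \<subseteq>\<^sub>m \<chi>" for \<chi>
    using closure_map_maximal[OF assms equi] that by blast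
  ultimately show "essential_iso (closure_map \<phi>) \<and> \<phi> \<subseteq>\<^sub>m closure_map \<phi> \<and>
      (\<forall>\<chi>. essential_iso \<chi> \<and> closure_map \<phi> \<subseteq>\<^sub>m \<chi> \<longrightarrow> \<chi> = closure_map \<phi>)"
    using map_le_closure_map[OF assms] map_le_antisym[OF max] map_le_trans[of \<phi> "closure_map \<phi>"]
    by blast
  then show "\<psi> = closure_map \<phi>"
    if "essential_iso \<psi> \<and> \<phi> \<subseteq>\<^sub>m \<psi> \<and> (\<forall>\<chi>. essential_iso \<chi> \<and> \<psi> \<subseteq>\<^sub>m \<chi> \<longrightarrow> \<chi> = \<psi>)" for \<psi>
    using that max by metis
qed

text \<open>The tool behind the group laws: two closures coincide as soon as one underlying map
  restricts the other. To get from \<phi> to \<psi>, a point in the domain of \<psi> is padded into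
  the domain of \<phi> and the padding is cancelled afterwards.\<close>

lemma closure_map_cong:
  assumes "cofinite_iso \<phi>" "cofinite_iso \<psi>" "\<phi> \<subseteq>\<^sub>m \<psi>"
  shows "closure_map \<phi> = closure_map \<psi>"
proof (rule map_le_antisym)
  have "\<phi> \<subseteq>\<^sub>m closure_map \<psi>"
    using assms map_le_closure_map map_le_trans by blast
  then show "closure_map \<psi> \<subseteq>\<^sub>m closure_map \<phi>"
    by (rule closure_map_maximal[OF assms(1) cofinite_iso_equivariant[OF cofinite_iso_closure_map[OF assms(2)]]])
  obtain N where N: "\<And>s. N \<le> length s \<Longrightarrow> \<exists>t. \<phi> s = Some t"
    using cofinite_iso_long[OF assms(1)] by blast
  have "closure_map \<psi> s = Some t" if s: "closure_map \<phi> s = Some t" for s t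
    unfolding closure_map_iff[OF assms(2)]
  proof (intro allI impI)
    fix z assume "s @ z \<in> dom \<psi>"
    then obtain u where u: "\<psi> (s @ z) = Some u" by blast
    let ?y = "replicate N False"
    have dom: "s @ (z @ ?y) \<in> dom \<phi>" using N[of "s @ (z @ ?y)"] by auto
    then have "\<phi> (s @ z @ ?y) = Some (t @ z @ ?y)"
      using s closure_map_iff[OF assms(1)] by blast
    moreover have "\<psi> (s @ z @ ?y) = Some (u @ ?y)"
      using equivariantD[OF cofinite_iso_equivariant[OF assms(2)] u, of ?y] by simp
    ultimately have "u @ ?y = (t @ z) @ ?y"
      using assms(3) dom by (auto simp: map_le_def)
    then show "\<psi> (s @ z) = Some (t @ z)" using u by simp
  qed
  then show "closure_map \<phi> \<subseteq>\<^sub>m closure_map \<psi>"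
    unfolding map_le_def by force
qed

section \<open>Composition, inverses and the group laws\<close>

lemma cofinite_iso_comp:
  assumes "cofinite_iso \<phi>" "cofinite_iso \<psi>"
  shows "cofinite_iso (\<phi> \<circ>\<^sub>m \<psi>)"
proof -
  obtain M where M: "\<And>s. M \<le> length s \<Longrightarrow> \<exists>t. \<phi> s = Some t"
    "\<And>s. M \<le> length s \<Longrightarrow> \<exists>r. \<phi> r = Some s"
    using cofinite_iso_long[OF assms(1)] by blast
  obtain N where N: "\<And>s. N \<le> length s \<Longrightarrow> \<exists>t. \<psi> s = Some t"
    "\<And>s. N \<le> length s \<Longrightarrow> \<exists>r. \<psi> r = Some s"
    using cofinite_iso_long[OF assms(2)] by blast
  note equi = equivariantD[OF cofinite_iso_equivariant]
  show ?thesis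
  proof (rule cofinite_isoI[of _ "M + N"])
    show "(\<phi> \<circ>\<^sub>m \<psi>) (r @ z) = Some (t @ z)" if "(\<phi> \<circ>\<^sub>m \<psi>) r = Some t" for r t z
      using that equi[OF assms(1)] equi[OF assms(2)] by (auto simp: map_comp_Some_iff)
    show "r = s" if "(\<phi> \<circ>\<^sub>m \<psi>) r = Some t" "(\<phi> \<circ>\<^sub>m \<psi>) s = Some t" for r s t
      using that cofinite_iso_inj[OF assms(1)] cofinite_iso_inj[OF assms(2)]
      unfolding map_comp_Some_iff by blast
    show "\<exists>t. (\<phi> \<circ>\<^sub>m \<psi>) s = Some t" if s: "M + N \<le> length s" for s
    proof -
      \<comment> \<open>\<psi> acts on the first \<open>N\<close> bits only; by equivariance the
        remaining bits, at least \<open>M\<close> of them, survive as a suffix, so the image is long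
        enough for \<phi>.\<close>
      obtain t where "\<psi> (take N s) = Some t" using N(1)[of "take N s"] s by auto
      then have t: "\<psi> s = Some (t @ drop N s)"
        using equi[OF assms(2), of "take N s" t "drop N s"] by simp
      have "M \<le> length (t @ drop N s)" using s by simp
      then obtain u where "\<phi> (t @ drop N s) = Some u" using M(1) by blast
      then show ?thesis using t by simp
    qed
    show "\<exists>r. (\<phi> \<circ>\<^sub>m \<psi>) r = Some s" if s: "M + N \<le> length s" for s
    proof -
      obtain r where "\<phi> r = Some (take M s)" using M(2)[of "take M s"] s by auto
      then have r: "\<phi> (r @ drop M s) = Some s"
        using equi[OF assms(1), of r "take M s" "drop M s"] by simp
      have "N \<le> length (r @ drop M s)" using s by simp
      then obtain q where "\<psi> q = Some (r @ drop M s)" using N(2) by blast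
      then show ?thesis using r by (metis map_comp_simps(2))
    qed
  qed
qed

lemma cofinite_iso_inverse:
  assumes "cofinite_iso \<phi>"
  obtains \<psi> where "cofinite_iso \<psi>" "\<And>s t. \<psi> t = Some s \<longleftrightarrow> \<phi> s = Some t"
proof
  define \<psi> where "\<psi> t = (if t \<in> ran \<phi> then Some (SOME s. \<phi> s = Some t) else None)" for t
  show *: "\<psi> t = Some s \<longleftrightarrow> \<phi> s = Some t" for s t
    using cofinite_iso_inj[OF assms, of _ t] someI_ex[of "\<lambda>s. \<phi> s = Some t"]
    by (auto simp: \<psi>_def ran_def)
  obtain N where N: "\<And>s. N \<le> length s \<Longrightarrow> \<exists>t. \<phi> s = Some t"
    "\<And>s. N \<le> length s \<Longrightarrow> \<exists>r. \<phi> r = Some s"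
    using cofinite_iso_long[OF assms] by blast
  show "cofinite_iso \<psi>"
  proof (rule cofinite_isoI[of _ N])
    show "r = s" if "\<psi> r = Some t" "\<psi> s = Some t" for r s t
      using that by (simp add: *)
  qed (use N in \<open>simp_all add: * equivariantD[OF cofinite_iso_equivariant[OF assms]]\<close>)
qed

lemma cofinite_iso_Some: "cofinite_iso Some"
  by (rule cofinite_isoI[of _ 0]) auto

lemma closure_map_Some: "closure_map Some = Some"
proof
  fix s :: bits
  show "closure_map Some s = Some s"
    using closure_map_extends[OF cofinite_iso_Some] by blast
qed

lemma carrier_G21: "\<phi> \<in> carrier G21 \<longleftrightarrow> cofinite_iso \<phi> \<and> closure_map \<phi> = \<phi>"
  by (auto simp: G21_def fin_gen_essential_iso_iff max_ext_eq_closure_map)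

lemma mult_G21:
  assumes "cofinite_iso \<phi>" "cofinite_iso \<psi>"
  shows "\<phi> \<otimes>\<^bsub>G21\<^esub> \<psi> = closure_map (\<phi> \<circ>\<^sub>m \<psi>)"
  using cofinite_iso_comp[OF assms] by (simp add: G21_def max_ext_eq_closure_map)

lemma one_G21: "\<one>\<^bsub>G21\<^esub> = Some"
  by (simp add: G21_def)

lemma closure_map_idem: "cofinite_iso \<phi> \<Longrightarrow> closure_map (closure_map \<phi>) = closure_map \<phi>"
  using closure_map_cong[OF _ cofinite_iso_closure_map map_le_closure_map] by metis

lemma closure_map_in_carrier: "cofinite_iso \<phi> \<Longrightarrow> closure_map \<phi> \<in> carrier G21"
  by (simp add: carrier_G21 cofinite_iso_closure_map closure_map_idem)

lemma mult_G21_closed: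
  assumes "cofinite_iso \<phi>" "cofinite_iso \<psi>"
  shows "\<phi> \<otimes>\<^bsub>G21\<^esub> \<psi> \<in> carrier G21"
  using assms by (simp add: mult_G21 closure_map_in_carrier cofinite_iso_comp)

lemma map_comp_mono: "\<phi> \<subseteq>\<^sub>m \<phi>' \<Longrightarrow> \<psi> \<subseteq>\<^sub>m \<psi>' \<Longrightarrow> \<phi> \<circ>\<^sub>m \<psi> \<subseteq>\<^sub>m \<phi>' \<circ>\<^sub>m \<psi>'"
  unfolding map_le_def map_comp_def dom_def by (force split: option.splits)

text \<open>Composition of partial maps is associative, and both bracketed products are closures of
  extensions of the same triple composition.\<close>

lemma mult_G21_assoc:
  assumes "cofinite_iso \<phi>" "cofinite_iso \<psi>" "cofinite_iso \<chi>"
  shows "(\<phi> \<otimes>\<^bsub>G21\<^esub> \<psi>) \<otimes>\<^bsub>G21\<^esub> \<chi> = \<phi> \<otimes>\<^bsub>G21\<^esub> (\<psi> \<otimes>\<^bsub>G21\<^esub> \<chi>)"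
proof -
  note iso = assms cofinite_iso_comp cofinite_iso_closure_map
  have "\<phi> \<circ>\<^sub>m (\<psi> \<circ>\<^sub>m \<chi>) = (\<phi> \<circ>\<^sub>m \<psi>) \<circ>\<^sub>m \<chi>"
    by (auto simp: map_comp_def split: option.splits)
  moreover have "(\<phi> \<circ>\<^sub>m \<psi>) \<circ>\<^sub>m \<chi> \<subseteq>\<^sub>m closure_map (\<phi> \<circ>\<^sub>m \<psi>) \<circ>\<^sub>m \<chi>"
    "\<phi> \<circ>\<^sub>m (\<psi> \<circ>\<^sub>m \<chi>) \<subseteq>\<^sub>m \<phi> \<circ>\<^sub>m closure_map (\<psi> \<circ>\<^sub>m \<chi>)"
    by (intro map_comp_mono map_le_closure_map map_le_refl iso)+
  ultimately have "closure_map (closure_map (\<phi> \<circ>\<^sub>m \<psi>) \<circ>\<^sub>m \<chi>) =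
      closure_map (\<phi> \<circ>\<^sub>m closure_map (\<psi> \<circ>\<^sub>m \<chi>))"
    using closure_map_cong iso by metis
  then show ?thesis
    using iso by (simp add: mult_G21)
qed

lemma Some_map_comp: "Some \<circ>\<^sub>m \<phi> = \<phi>"
  by (simp add: map_comp_def fun_eq_iff split: option.split)

text \<open>\<open>groupI\<close> asks for left inverses only. The closure of the partial inverse
  \<psi> serves: \<psi> after \<phi> is a restriction of the identity, so its closure is the
  identity.\<close>

lemma group_G21: "group G21"
proof (rule groupI)
  fix \<phi> assume \<phi>: "\<phi> \<in> carrier G21"
  then have iso: "cofinite_iso \<phi>" by (simp add: carrier_G21)
  show "\<one>\<^bsub>G21\<^esub> \<otimes>\<^bsub>G21\<^esub> \<phi> = \<phi>"
    using \<phi> by (simp add: one_G21 mult_G21 cofinite_iso_Some carrier_G21 Some_map_comp)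
  obtain \<psi> where \<psi>: "cofinite_iso \<psi>" "\<And>s t. \<psi> t = Some s \<longleftrightarrow> \<phi> s = Some t"
    using cofinite_iso_inverse[OF iso] by blast
  have le: "\<psi> \<circ>\<^sub>m \<phi> \<subseteq>\<^sub>m closure_map \<psi> \<circ>\<^sub>m \<phi>"
    by (intro map_comp_mono map_le_closure_map map_le_refl \<psi>)
  have "\<psi> \<circ>\<^sub>m \<phi> \<subseteq>\<^sub>m Some"
    by (auto simp: map_le_def map_comp_Some_iff \<psi>(2) cofinite_iso_inj[OF iso])
  then have "closure_map (\<psi> \<circ>\<^sub>m \<phi>) = Some"
    using closure_map_cong \<psi>(1) iso closure_map_Some cofinite_iso_comp cofinite_iso_Some by metis
  then have "closure_map \<psi> \<otimes>\<^bsub>G21\<^esub> \<phi> = \<one>\<^bsub>G21\<^esub>"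
    using closure_map_cong[OF _ _ le] iso \<psi>(1)
    by (simp add: mult_G21 cofinite_iso_closure_map cofinite_iso_comp one_G21)
  then show "\<exists>\<psi>\<in>carrier G21. \<psi> \<otimes>\<^bsub>G21\<^esub> \<phi> = \<one>\<^bsub>G21\<^esub>"
    using closure_map_in_carrier[OF \<psi>(1)] by blast
qed (auto simp: carrier_G21 mult_G21_assoc one_G21 cofinite_iso_Some closure_map_Some
      mult_G21_closed[unfolded carrier_G21])

section \<open>Words\<close>

lemma cofinite_iso_tau:
  assumes "1 \<le> i"
  shows "cofinite_iso (tau i (i + 1))"
proof -
  \<comment> \<open>An adjacent transposition undoes itself; this gives both injectivity and
    surjectivity on long words.\<close>
  have inv: "tau i (i + 1) t = Some s" if "tau i (i + 1) s = Some t" for s t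
  proof -
    obtain k where k: "i = Suc k" using assms by (cases i) auto
    have len: "Suc k < length s" and t: "t = s[k := s ! Suc k, Suc k := s ! k]"
      using that by (simp_all add: tau_def k split: if_splits)
    have "s = t[k := t ! Suc k, Suc k := t ! k]"
      unfolding t using len by (intro nth_equalityI) (simp_all add: nth_list_update)
    moreover have "length t = length s" using t by simp
    ultimately show ?thesis using len by (simp add: tau_def k)
  qed
  have dom: "\<exists>t. tau i (i + 1) s = Some t" if "i + 1 \<le> length s" for s
    using that assms by (simp add: tau_def)
  show ?thesis
  proof (rule cofinite_isoI[of _ "i + 1"])
    show "tau i (i + 1) (r @ z) = Some (t @ z)" if "tau i (i + 1) r = Some t" for r t z
      using that by (auto simp: tau_def list_update_append nth_append split: if_splits)
    show "r = s" if "tau i (i + 1) r = Some t" "tau i (i + 1) s = Some t" for r s t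
      using inv[OF that(1)] inv[OF that(2)] by simp
  qed (use dom inv in blast)+
qed

lemma cofinite_iso_letter:
  assumes "\<Gamma> \<subseteq> carrier G21" "letter_over \<Gamma> l"
  shows "cofinite_iso (letter_val l)"
proof (cases l)
  case (GenInv g)
  then have "inv\<^bsub>G21\<^esub> g \<in> carrier G21"
    using assms group.inv_closed[OF group_G21] by auto
  then show ?thesis using GenInv by (simp add: carrier_G21)
qed (use assms cofinite_iso_tau in \<open>auto simp: carrier_G21\<close>)

lemma word_val_Nil [simp]: "word_val [] = \<one>\<^bsub>G21\<^esub>"
  by (simp add: word_val_def)

lemma word_val_Cons [simp]: "word_val (l # W) = letter_val l \<otimes>\<^bsub>G21\<^esub> word_val W"
  by (simp add: word_val_def)

lemma word_val_in_carrier: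
  assumes "\<Gamma> \<subseteq> carrier G21" "\<forall>l\<in>set W. letter_over \<Gamma> l"
  shows "word_val W \<in> carrier G21"
  using assms(2)
proof (induction W)
  case Nil
  show ?case using monoid.one_closed[OF group.is_monoid[OF group_G21]] by simp
next
  case (Cons l W)
  then show ?case
    using cofinite_iso_letter[OF assms(1)] by (simp add: mult_G21_closed carrier_G21[THEN iffD1])
qed

lemma word_val_append:
  assumes "\<Gamma> \<subseteq> carrier G21" "\<forall>l\<in>set (V @ W). letter_over \<Gamma> l"
  shows "word_val (V @ W) = word_val V \<otimes>\<^bsub>G21\<^esub> word_val W"
  using assms(2)
proof (induction V)
  case Nil
  then show ?case
    using monoid.l_one[OF group.is_monoid[OF group_G21] word_val_in_carrier[OF assms(1)]]
    by simp
next
  case (Cons l V)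
  then show ?case
    using cofinite_iso_letter[OF assms(1)] word_val_in_carrier[OF assms(1)]
    by (simp add: mult_G21_assoc carrier_G21[THEN iffD1])
qed

text \<open>Since a product extends the composition, the image of a bitstring can be traced through
  a word block by block, rightmost block first, without computing a maximal extension.\<close>

lemma word_val_append_Some:
  assumes \<Gamma>: "\<Gamma> \<subseteq> carrier G21" and over: "\<forall>l\<in>set (V @ W). letter_over \<Gamma> l"
    and s: "word_val W s = Some t" and t: "word_val V t = Some u"
  shows "word_val (V @ W) s = Some u"
proof -
  have iso: "cofinite_iso (word_val V)" "cofinite_iso (word_val W)"
    using over word_val_in_carrier[OF \<Gamma>] by (simp_all add: carrier_G21)
  have "(word_val V \<circ>\<^sub>m word_val W) s = Some u"
    using s t by simp
  then show ?thesis
    unfolding word_val_append[OF \<Gamma> over] mult_G21[OF iso]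
    using closure_map_extends cofinite_iso_comp iso by blast
qed

text \<open>The closure appears because even a one-letter word is a product with the identity; it
  disappears for letters already in the carrier.\<close>

lemma word_val_singleton:
  assumes "cofinite_iso (letter_val l)"
  shows "word_val [l] = closure_map (letter_val l)"
proof -
  have "letter_val l \<circ>\<^sub>m Some = letter_val l"
    by (simp add: map_comp_def)
  then show ?thesis
    using mult_G21[OF assms cofinite_iso_Some] by (simp add: one_G21)
qed

text \<open>Excluding \<open>Tau\<close> letters guarantees that such words never affect the bound
  on the subscripts.\<close>

lemma word_of_generated:
  assumes "\<Gamma> \<subseteq> carrier G21" "g \<in> generate G21 \<Gamma>"
  shows "\<exists>W. (\<forall>l\<in>set W. letter_over \<Gamma> l) \<and> (\<forall>i. Tau i \<notin> set W) \<and> word_val W = g"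
  using assms(2)
proof (induction rule: generate.induct)
  case one
  show ?case by (rule exI[of _ "[]"]) simp
next
  case (incl h)
  then have "word_val [Gen h] = h"
    using assms(1) by (subst word_val_singleton) (auto simp: carrier_G21)
  then show ?case using incl by (intro exI[of _ "[Gen h]"]) simp
next
  case (inv h)
  then have "inv\<^bsub>G21\<^esub> h \<in> carrier G21"
    using assms(1) group.inv_closed[OF group_G21] by blast
  then have "word_val [GenInv h] = inv\<^bsub>G21\<^esub> h"
    by (subst word_val_singleton) (auto simp: carrier_G21)
  then show ?case using inv by (intro exI[of _ "[GenInv h]"]) simp
next
  case (eng h1 h2)
  then obtain V W where "\<forall>l\<in>set V. letter_over \<Gamma> l" "\<forall>i. Tau i \<notin> set V" "word_val V = h1"
    "\<forall>l\<in>set W. letter_over \<Gamma> l" "\<forall>i. Tau i \<notin> set W" "word_val W = h2"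
    by blast
  then show ?case
    by (intro exI[of _ "V @ W"]) (auto intro!: word_val_append[OF assms(1)])
qed

text \<open>The source of all constants: a fixed partial map is realised by a fixed word over
  \<Gamma>, whose length is independent of any circuit.\<close>

lemma word_of_iso:
  assumes "\<Gamma> \<subseteq> carrier G21" "generate G21 \<Gamma> = carrier G21" "cofinite_iso \<phi>"
  shows "\<exists>W. (\<forall>l\<in>set W. letter_over \<Gamma> l) \<and> (\<forall>i. Tau i \<notin> set W) \<and>
           (\<forall>s t. \<phi> s = Some t \<longrightarrow> word_val W s = Some t)"
  using word_of_generated[OF assms(1), of "closure_map \<phi>"] assms(2,3)
    closure_map_in_carrier closure_map_extends by metis

section \<open>Reversible programs\<close>

text \<open>A bitstring of length \<open>L\<close> is viewed as a state \<sigma> of cells 0 to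
  \<open>L - 1\<close>, and \<open>n\<close> bounds the word length. States are total functions, so
  that operations compose without side conditions on \<open>L\<close>.\<close>

definition implementable ::
  "(bits \<rightharpoonup> bits) set \<Rightarrow> nat \<Rightarrow> nat \<Rightarrow> ((nat \<Rightarrow> bool) \<Rightarrow> nat \<Rightarrow> bool) \<Rightarrow> bool" where
  "implementable \<Gamma> L n F \<longleftrightarrow>
     (\<exists>W. (\<forall>l\<in>set W. letter_over \<Gamma> l) \<and> (\<forall>i. Tau i \<in> set W \<longrightarrow> i + 1 \<le> L) \<and> length W \<le> n \<and>
          (\<forall>\<sigma>. word_val W (map \<sigma> [0..<L]) = Some (map (F \<sigma>) [0..<L])))"

lemma implementable_mono: "implementable \<Gamma> L n F \<Longrightarrow> n \<le> k \<Longrightarrow> implementable \<Gamma> L k F"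
  unfolding implementable_def by (meson le_trans)

lemma implementable_id: "implementable \<Gamma> L n id"
  unfolding implementable_def by (rule exI[of _ "[]"]) (simp add: one_G21)

lemma implementable_comp:
  assumes \<Gamma>: "\<Gamma> \<subseteq> carrier G21"
    and "implementable \<Gamma> L n F" "implementable \<Gamma> L k G"
  shows "implementable \<Gamma> L (n + k) (F \<circ> G)"
proof -
  obtain V where V: "\<forall>l\<in>set V. letter_over \<Gamma> l" "\<forall>i. Tau i \<in> set V \<longrightarrow> i + 1 \<le> L" "length V \<le> n"
    "\<And>\<sigma>. word_val V (map \<sigma> [0..<L]) = Some (map (F \<sigma>) [0..<L])"
    using assms(2) unfolding implementable_def by blast
  obtain W where W: "\<forall>l\<in>set W. letter_over \<Gamma> l" "\<forall>i. Tau i \<in> set W \<longrightarrow> i + 1 \<le> L" "length W \<le> k"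
    "\<And>\<sigma>. word_val W (map \<sigma> [0..<L]) = Some (map (G \<sigma>) [0..<L])"
    using assms(3) unfolding implementable_def by blast
  have over: "\<forall>l\<in>set (V @ W). letter_over \<Gamma> l"
    using V(1) W(1) by auto
  have "word_val (V @ W) (map \<sigma> [0..<L]) = Some (map ((F \<circ> G) \<sigma>) [0..<L])" for \<sigma>
    using word_val_append_Some[OF \<Gamma> over W(4) V(4)] by simp
  then show ?thesis
    unfolding implementable_def using over V(2,3) W(2,3)
    by (intro exI[of _ "V @ W"]) auto
qed

section \<open>Transpositions of arbitrary cells\<close>

lemma implementable_adjacent_transpose:
  assumes "Suc a < L"
  shows "implementable \<Gamma> L 1 (\<lambda>\<sigma>. \<sigma> \<circ> transpose a (Suc a))"
proof -
  \<comment> \<open>\<open>Tau\<close> counts positions from 1, while cells are counted from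
    0.\<close>
  have "word_val [Tau (Suc a)] (map \<sigma> [0..<L]) = Some (map (\<sigma> \<circ> transpose a (Suc a)) [0..<L])" for \<sigma>
  proof -
    have iso: "cofinite_iso (letter_val (Tau (Suc a)))"
      using cofinite_iso_tau[of "Suc a"] by simp
    have "(map \<sigma> [0..<L])[a := \<sigma> (Suc a), Suc a := \<sigma> a] =
        map (\<sigma> \<circ> transpose a (Suc a)) [0..<L]"
      using assms by (intro nth_equalityI) (auto simp: nth_list_update transpose_def)
    then have "letter_val (Tau (Suc a)) (map \<sigma> [0..<L]) = Some (map (\<sigma> \<circ> transpose a (Suc a)) [0..<L])"
      using assms by (simp add: tau_def)
    then show ?thesis
      unfolding word_val_singleton[OF iso] by (rule closure_map_extends[OF iso])
  qed
  then show ?thesis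
    unfolding implementable_def using assms by (intro exI[of _ "[Tau (Suc a)]"]) auto
qed

text \<open>Conjugating the swap of \<open>a\<close> and \<open>b\<close> by the adjacent swap of
  \<open>b\<close> and \<open>Suc b\<close> gives the swap of \<open>a\<close> and
  \<open>Suc b\<close>, so each unit of distance costs at most two letters.\<close>

lemma implementable_transpose:
  assumes \<Gamma>: "\<Gamma> \<subseteq> carrier G21" and "a < L" "b < L"
  shows "implementable \<Gamma> L (2 * L) (\<lambda>\<sigma>. \<sigma> \<circ> transpose a b)"
proof -
  have ordered: "implementable \<Gamma> L (2 * (b - a)) (\<lambda>\<sigma>. \<sigma> \<circ> transpose a b)" if "a \<le> b" "b < L" for a b
    using that
  proof (induction b rule: dec_induct)
    case base
    then show ?case using implementable_id by (simp add: id_def)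
  next
    case (step b)
    have adj: "implementable \<Gamma> L 1 (\<lambda>\<sigma>. \<sigma> \<circ> transpose b (Suc b))"
      using step.prems by (rule implementable_adjacent_transpose)
    show ?case
    proof (cases "a = b")
      case True
      show ?thesis
        unfolding True by (rule implementable_mono[OF adj]) simp
    next
      case False
      then have "transpose a (Suc b) = transpose b (Suc b) \<circ> transpose a b \<circ> transpose b (Suc b)"
        using step.hyps by (auto simp: transpose_def fun_eq_iff)
      then have eq: "(\<lambda>\<sigma>. \<sigma> \<circ> transpose a (Suc b)) = (\<lambda>\<sigma>. \<sigma> \<circ> transpose b (Suc b)) \<circ>
          ((\<lambda>\<sigma>. \<sigma> \<circ> transpose a b) \<circ> (\<lambda>\<sigma> :: nat \<Rightarrow> bool. \<sigma> \<circ> transpose b (Suc b)))"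
        by (simp add: fun_eq_iff)
      have "implementable \<Gamma> L (2 * (b - a)) (\<lambda>\<sigma>. \<sigma> \<circ> transpose a b)"
        by (rule step.IH) (use step.prems in simp)
      then have "implementable \<Gamma> L (1 + (2 * (b - a) + 1)) (\<lambda>\<sigma>. \<sigma> \<circ> transpose a (Suc b))"
        unfolding eq by (intro implementable_comp[OF \<Gamma>] adj)
      then show ?thesis
        by (rule implementable_mono) (use step.hyps in simp)
    qed
  qed
  show ?thesis
  proof (cases "a \<le> b")
    case True
    show ?thesis
      by (rule implementable_mono[OF ordered]) (use True assms in auto)
  next
    case False
    show ?thesis
      unfolding transpose_commute[of a b]
      by (rule implementable_mono[OF ordered]) (use False assms in auto)
  qed
qed

section \<open>Controlled negations on three cells\<close>

type_synonym xor_op = "(bool \<Rightarrow> bool \<Rightarrow> bool) \<times> nat \<times> nat \<times> nat"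

text \<open>A generalised Toffoli gate with an arbitrary control function \<open>h\<close>.\<close>

fun apply_op :: "xor_op \<Rightarrow> (nat \<Rightarrow> bool) \<Rightarrow> nat \<Rightarrow> bool" where
  "apply_op (h, i, j, k) \<sigma> = \<sigma>(k := (\<sigma> k \<noteq> h (\<sigma> i) (\<sigma> j)))"

text \<open>The map touches only the first three bits, so one word works for every \<open>L\<close>;
  it is an involution, hence an isomorphism.\<close>

lemma implementable_front_op:
  assumes "\<Gamma> \<subseteq> carrier G21" "generate G21 \<Gamma> = carrier G21"
  shows "\<exists>K. \<forall>L\<ge>3. \<forall>h. implementable \<Gamma> L K (apply_op (h, 0, 1, 2))"
proof -
  define \<phi> :: "(bool \<Rightarrow> bool \<Rightarrow> bool) \<Rightarrow> bits \<rightharpoonup> bits" where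
    "\<phi> h s = (case s of a # b # c # w \<Rightarrow> Some (a # b # (c \<noteq> h a b) # w) | _ \<Rightarrow> None)" for h s
  have \<phi>_iff: "\<phi> h s = Some t \<longleftrightarrow> (\<exists>a b c w. s = a # b # c # w \<and> t = a # b # (c \<noteq> h a b) # w)" for h s t
    by (auto simp: \<phi>_def split: list.splits)
  have sym: "\<phi> h s = Some t \<longleftrightarrow> \<phi> h t = Some s" for h s t
    unfolding \<phi>_iff by auto
  have long: "\<exists>t. \<phi> h s = Some t" if "3 \<le> length s" for h s
    using that by (auto simp: \<phi>_def numeral_3_eq_3 Suc_le_length_iff)
  have "cofinite_iso (\<phi> h)" for h
  proof (rule cofinite_isoI[of _ 3])
    show "r = s" if "\<phi> h r = Some t" "\<phi> h s = Some t" for r s t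
      using that sym by (metis option.inject)
    show "\<exists>r. \<phi> h r = Some s" if "3 \<le> length s" for s
      using long[OF that] sym by blast
  qed (use long in \<open>auto simp: \<phi>_iff\<close>)
  then have "\<forall>h. \<exists>W. (\<forall>l\<in>set W. letter_over \<Gamma> l) \<and> (\<forall>i. Tau i \<notin> set W) \<and>
           (\<forall>s t. \<phi> h s = Some t \<longrightarrow> word_val W s = Some t)"
    using word_of_iso[OF assms] by blast
  then obtain W where W: "\<And>h. \<forall>l\<in>set (W h). letter_over \<Gamma> l" "\<And>h i. Tau i \<notin> set (W h)"
    "\<And>h s t. \<phi> h s = Some t \<Longrightarrow> word_val (W h) s = Some t"
    by metis
  \<comment> \<open>The maximum exists because there are only 16 control functions
    \<open>h\<close>.\<close>
  have "length (W h) \<le> Max (range (\<lambda>h. length (W h)))" for h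
    by (rule Max_ge) auto
  moreover have "word_val (W h) (map \<sigma> [0..<L]) = Some (map (apply_op (h, 0, 1, 2) \<sigma>) [0..<L])"
    if "3 \<le> L" for h \<sigma> L
  proof -
    have "[0..<L] = 0 # 1 # 2 # [3..<L]"
      using that by (simp add: upt_conv_Cons numeral_2_eq_2 numeral_3_eq_3)
    then show ?thesis
      by (intro W(3)) (auto simp: \<phi>_def)
  qed
  ultimately show ?thesis
    unfolding implementable_def using W(1,2) by blast
qed

text \<open>Conjugation by a swap of cells relabels the operands; the two swaps cost
  \<open>2 * L\<close> letters each.\<close>

lemma implementable_conj:
  assumes \<Gamma>: "\<Gamma> \<subseteq> carrier G21" and "implementable \<Gamma> L n (apply_op (h, i, j, k))" "a < L" "b < L"
  shows "implementable \<Gamma> L (n + 4 * L)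
    (apply_op (h, transpose a b i, transpose a b j, transpose a b k))"
proof -
  have "apply_op (h, transpose a b i, transpose a b j, transpose a b k) =
      (\<lambda>\<sigma>. \<sigma> \<circ> transpose a b) \<circ> (apply_op (h, i, j, k) \<circ> (\<lambda>\<sigma>. \<sigma> \<circ> transpose a b))"
    by (auto simp: fun_eq_iff transpose_eq_iff)
  moreover have "implementable \<Gamma> L (2 * L + (n + 2 * L)) \<dots>"
    using assms by (intro implementable_comp implementable_transpose)
  ultimately show ?thesis by (simp add: ac_simps)
qed

text \<open>The target differs from the controls, which makes the operation self-inverse. The
  controls may coincide, and cell 0 is kept free.\<close>

definition valid_op :: "nat \<Rightarrow> xor_op \<Rightarrow> bool" where
  "valid_op L = (\<lambda>(h, i, j, k). {i, j, k} \<subseteq> {0<..<L} \<and> k \<noteq> i \<and> k \<noteq> j)"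

text \<open>Three conjugations carry the cells 0, 1, 2 to \<open>i\<close>, \<open>j\<close>,
  \<open>k\<close>: swap 2 with \<open>k2\<close>, then 1 with \<open>j1\<close>, then 0 with
  \<open>i\<close>. The auxiliary cells are found backwards, by undoing the later swaps on
  \<open>j\<close> and \<open>k\<close>.\<close>

lemma implementable_distinct_op:
  assumes \<Gamma>: "\<Gamma> \<subseteq> carrier G21" and K: "\<And>h. implementable \<Gamma> L K (apply_op (h, 0, 1, 2))"
    and "i < L" "j < L" "k < L" "i \<noteq> j" "k \<noteq> i" "k \<noteq> j"
  shows "implementable \<Gamma> L (K + 12 * L) (apply_op (h, i, j, k))"
proof -
  have L: "3 \<le> L" using assms(3-8) by linarith
  define j1 where "j1 = transpose 0 i j"
  define k1 where "k1 = transpose 0 i k"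
  have 1: "j1 \<noteq> 0" "k1 \<noteq> 0" "k1 \<noteq> j1" "j1 < L" "k1 < L"
    using assms(3-8) L by (auto simp: j1_def k1_def transpose_def)
  define k2 where "k2 = transpose 1 j1 k1"
  have 2: "k2 \<noteq> 0" "k2 \<noteq> 1" "k2 < L"
    using 1 L by (auto simp: k2_def transpose_def)
  have "implementable \<Gamma> L (K + 4 * L) (apply_op (h, 0, 1, k2))"
    using implementable_conj[OF \<Gamma> K, of 2 k2 h] 2 L by simp
  then have "implementable \<Gamma> L (K + 4 * L + 4 * L) (apply_op (h, 0, j1, k1))"
    using implementable_conj[OF \<Gamma>, of L "K + 4 * L" h 0 1 k2 1 j1] 1 L by (simp add: k2_def)
  then have "implementable \<Gamma> L (K + 4 * L + 4 * L + 4 * L) (apply_op (h, i, j, k))"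
    using implementable_conj[OF \<Gamma>, of L "K + 4 * L + 4 * L" h 0 j1 k1 0 i] assms(3) L by (simp add: j1_def k1_def)
  then show ?thesis by (simp add: ac_simps)
qed

text \<open>Both arguments of an operation may be the same cell, because forks are compiled
  to aliases; the otherwise unused cell 0 then serves as a dummy second argument.\<close>

lemma implementable_valid_op:
  assumes \<Gamma>: "\<Gamma> \<subseteq> carrier G21" and K: "\<And>L h. 3 \<le> L \<Longrightarrow> implementable \<Gamma> L K (apply_op (h, 0, 1, 2))"
    and "valid_op L p"
  shows "implementable \<Gamma> L (K + 12 * L) (apply_op p)"
proof -
  obtain h i j k where p: "p = (h, i, j, k)" by (cases p)
  have v: "0 < i" "i < L" "0 < j" "j < L" "0 < k" "k < L" "k \<noteq> i" "k \<noteq> j"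
    using assms(3) by (auto simp: valid_op_def p)
  then have L: "3 \<le> L" by linarith
  show ?thesis
  proof (cases "i = j")
    case True
    then have "apply_op p = apply_op (\<lambda>a _. h a a, i, 0, k)"
      by (simp add: p fun_eq_iff)
    then show ?thesis
      using implementable_distinct_op[OF \<Gamma> K[OF L], of i 0 k] v by simp
  next
    case False
    then show ?thesis
      using implementable_distinct_op[OF \<Gamma> K[OF L]] v by (simp add: p)
  qed
qed

lemma implementable_program:
  assumes \<Gamma>: "\<Gamma> \<subseteq> carrier G21" and K: "\<And>L h. 3 \<le> L \<Longrightarrow> implementable \<Gamma> L K (apply_op (h, 0, 1, 2))"
    and "\<forall>p\<in>set ops. valid_op L p"
  shows "implementable \<Gamma> L (length ops * (K + 12 * L)) (fold apply_op ops)"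
  using assms(3)
proof (induction ops)
  case Nil
  then show ?case using implementable_id by (simp add: id_def)
next
  case (Cons p ops)
  then have "implementable \<Gamma> L (length ops * (K + 12 * L) + (K + 12 * L)) (fold apply_op ops \<circ> apply_op p)"
    by (intro implementable_comp[OF \<Gamma>] implementable_valid_op[OF \<Gamma> K]) auto
  moreover have "fold apply_op (p # ops) = fold apply_op ops \<circ> apply_op p"
    by (simp add: fun_eq_iff)
  moreover have "length (p # ops) * (K + 12 * L) = length ops * (K + 12 * L) + (K + 12 * L)"
    by simp
  ultimately show ?case by (simp only:)
qed

text \<open>Uncomputation: no target is among its own controls, so applying an operation twice flips
  the target by the same bit twice.\<close>

lemma fold_apply_op_rev:
  assumes "\<forall>(h, i, j, k)\<in>set ops. k \<noteq> i \<and> k \<noteq> j"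
  shows "fold apply_op (rev ops) (fold apply_op ops \<sigma>) = \<sigma>"
  using assms
proof (induction ops arbitrary: \<sigma>)
  case (Cons p ops)
  then show ?case by (cases p) (auto simp: fun_eq_iff)
qed simp

lemma fold_apply_op_untouched:
  assumes "\<forall>(h, i, j, k)\<in>set ops. k \<noteq> p"
  shows "fold apply_op ops \<sigma> p = \<sigma> p"
  using assms
proof (induction ops arbitrary: \<sigma>)
  case (Cons q ops)
  then show ?case by (cases q) auto
qed simp

text \<open>Operations commute with overwriting cells that they neither read nor write. This lets
  the uncomputation pass the copied output.\<close>

lemma fold_apply_op_override_on:
  assumes "\<forall>(h, i, j, k)\<in>set ops. {i, j, k} \<inter> Y = {}"
  shows "fold apply_op ops (override_on \<sigma> \<tau> Y) = override_on (fold apply_op ops \<sigma>) \<tau> Y"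
  using assms
proof (induction ops arbitrary: \<sigma>)
  case (Cons q ops)
  obtain h i j k where q: "q = (h, i, j, k)" by (cases q)
  have "apply_op q (override_on \<sigma> \<tau> Y) = override_on (apply_op q \<sigma>) \<tau> Y"
    using Cons.prems by (auto simp: q fun_eq_iff override_on_def)
  then show ?case using Cons by simp
qed simp

text \<open>All sources lie outside the target block, so earlier copies do not disturb later
  ones.\<close>

lemma fold_copy_ops:
  assumes "\<forall>q<n. src q \<notin> {y..<y + n}"
  shows "fold apply_op (map (\<lambda>q. (\<lambda>b _. b, src q, src q, y + q)) [0..<n]) \<sigma> =
    override_on \<sigma> (\<lambda>p. \<sigma> p \<noteq> \<sigma> (src (p - y))) {y..<y + n}"
  using assms
proof (induction n)
  case (Suc n)
  have "src n \<notin> {y..<y + n}" "\<forall>q<n. src q \<notin> {y..<y + n}"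
    using Suc.prems by (fastforce, metis add_Suc_right atLeastLessThan_iff less_SucI)
  then show ?case
    using Suc.IH by (auto simp: fun_eq_iff override_on_def)
qed (simp add: override_on_def)

section \<open>Compiling circuits\<close>

fun evaluable :: "nat set \<Rightarrow> gate list \<Rightarrow> bool" where
  "evaluable D [] \<longleftrightarrow> True"
| "evaluable D (g # gs) \<longleftrightarrow> set (gate_ins g) \<subseteq> D \<and> evaluable (D \<union> set (gate_outs g)) gs"

definition wires_out :: "gate set \<Rightarrow> nat set" where
  "wires_out G = (\<Union>g\<in>G. set (gate_outs g))"

text \<open>A gate producing a minimal wire among all gate outputs can come first: its inputs
  precede that wire, so none is a gate output and all lie in \<open>D\<close>. The rest follows by
  induction with its outputs added to \<open>D\<close>.\<close>

lemma evaluable_order: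
  assumes "finite G" "wf {(a, b). \<exists>g\<in>G. a \<in> set (gate_ins g) \<and> b \<in> set (gate_outs g)}"
    and "\<forall>g\<in>G. set (gate_ins g) \<subseteq> D \<union> wires_out G"
  shows "\<exists>gs. set gs = G \<and> length gs = card G \<and> evaluable D gs"
  using assms
proof (induction "card G" arbitrary: G D)
  case 0
  then show ?case by auto
next
  case (Suc n)
  let ?r = "{(a, b). \<exists>g\<in>G. a \<in> set (gate_ins g) \<and> b \<in> set (gate_outs g)}"
  obtain g0 where "g0 \<in> G" using Suc.hyps(2) by fastforce
  moreover have "\<exists>b. b \<in> set (gate_outs g0)" by (cases g0) auto
  ultimately obtain b0 where b0: "b0 \<in> wires_out G"
    unfolding wires_out_def by blast
  then obtain b where b: "b \<in> wires_out G" "\<And>a. (a, b) \<in> ?r \<Longrightarrow> a \<notin> wires_out G"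
    using wfE_min[OF Suc.prems(2) b0] by blast
  then obtain g where g: "g \<in> G" "b \<in> set (gate_outs g)"
    by (auto simp: wires_out_def)
  then have ins: "set (gate_ins g) \<subseteq> D"
    using b(2) Suc.prems(3) by blast
  let ?G = "G - {g}"
  have "wires_out G = set (gate_outs g) \<union> wires_out ?G"
    using g(1) by (auto simp: wires_out_def)
  then have "\<forall>g'\<in>?G. set (gate_ins g') \<subseteq> (D \<union> set (gate_outs g)) \<union> wires_out ?G"
    using Suc.prems(3) by auto
  moreover have "wf {(a, b). \<exists>g\<in>?G. a \<in> set (gate_ins g) \<and> b \<in> set (gate_outs g)}"
    by (rule wf_subset[OF Suc.prems(2)]) auto
  moreover have "n = card ?G"
    using Suc.hyps(2) Suc.prems(1) g(1) by simp
  ultimately obtain gs where gs: "set gs = ?G" "length gs = card ?G" "evaluable (D \<union> set (gate_outs g)) gs"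
    using Suc.hyps(1)[of ?G "D \<union> set (gate_outs g)"] Suc.prems(1) by blast
  then show ?case
    using ins g(1) Suc.hyps(2) \<open>n = card ?G\<close> by (intro exI[of _ "g # gs"]) auto
qed

text \<open>Forks and swaps only rename cells; each logical gate writes its value into one
  fresh cell \<open>a\<close> that holds \<open>False\<close>.\<close>

lemma compile_gate:
  assumes "set (gate_ins g) \<subseteq> D" "a \<notin> pos ` D"
  shows "\<exists>ops pos'. length ops \<le> 1 \<and>
    (\<forall>(h, i, j, k)\<in>set ops. i \<in> pos ` D \<and> j \<in> pos ` D \<and> k = a) \<and>
    pos' ` (D \<union> set (gate_outs g)) \<subseteq> insert a (pos ` D) \<and>
    (\<forall>\<sigma> v. \<not> \<sigma> a \<and> gate_holds v g \<and> (\<forall>w\<in>D. \<sigma> (pos w) = v w) \<longrightarrow>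
      (\<forall>w\<in>D \<union> set (gate_outs g). fold apply_op ops \<sigma> (pos' w) = v w))"
proof (cases g)
  case (And i j k)
  then show ?thesis using assms
    by (intro exI[of _ "[((\<and>), pos i, pos j, a)]"] exI[of _ "pos(k := a)"]) auto
next
  case (Or i j k)
  then show ?thesis using assms
    by (intro exI[of _ "[((\<or>), pos i, pos j, a)]"] exI[of _ "pos(k := a)"]) auto
next
  case (Not i k)
  then show ?thesis using assms
    by (intro exI[of _ "[(\<lambda>b _. \<not> b, pos i, pos i, a)]"] exI[of _ "pos(k := a)"]) auto
next
  case (Fork i k l)
  then show ?thesis using assms
    by (intro exI[of _ "[]"] exI[of _ "pos(k := pos i, l := pos i)"]) auto
next
  case (Swap i j k l)
  then show ?thesis using assms
    by (intro exI[of _ "[]"] exI[of _ "pos(k := pos j, l := pos i)"]) auto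
qed

text \<open>The first gate receives the scratch cell \<open>a\<close>, the remaining gates the block
  from \<open>Suc a\<close> on. The valuation \<open>v\<close> is fixed throughout, so the invariant
  is that the cell assigned to each available wire holds its value under \<open>v\<close>.\<close>

lemma compile_gates:
  assumes "evaluable D gs" "pos ` D \<inter> {a..<a + length gs} = {}"
  shows "\<exists>ops pos'. length ops \<le> length gs \<and>
    (\<forall>(h, i, j, k)\<in>set ops. {i, j} \<subseteq> pos ` D \<union> {a..<a + length gs} \<and>
      k \<in> {a..<a + length gs} \<and> k \<noteq> i \<and> k \<noteq> j) \<and>
    pos' ` (D \<union> wires_out (set gs)) \<subseteq> pos ` D \<union> {a..<a + length gs} \<and>
    (\<forall>\<sigma> v. (\<forall>p\<in>{a..<a + length gs}. \<not> \<sigma> p) \<and> (\<forall>g\<in>set gs. gate_holds v g) \<and>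
        (\<forall>w\<in>D. \<sigma> (pos w) = v w) \<longrightarrow>
      (\<forall>w\<in>D \<union> wires_out (set gs). fold apply_op ops \<sigma> (pos' w) = v w))"
  using assms
proof (induction gs arbitrary: D pos a)
  case Nil
  then show ?case by (intro exI[of _ "[]"] exI[of _ pos]) (auto simp: wires_out_def)
next
  case (Cons g gs)
  let ?D = "D \<union> set (gate_outs g)"
  let ?A = "{a..<a + length (g # gs)}"
  let ?B = "{Suc a..<Suc a + length gs}"
  have A: "?A = insert a ?B" "a \<notin> ?B" by auto
  have a: "a \<notin> pos ` D" using Cons.prems(2) A(1) by blast
  obtain ops1 pos1 where 1: "length ops1 \<le> 1"
    "\<forall>(h, i, j, k)\<in>set ops1. i \<in> pos ` D \<and> j \<in> pos ` D \<and> k = a"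
    "pos1 ` ?D \<subseteq> insert a (pos ` D)"
    "\<And>\<sigma> v. \<not> \<sigma> a \<Longrightarrow> gate_holds v g \<Longrightarrow> \<forall>w\<in>D. \<sigma> (pos w) = v w \<Longrightarrow>
      \<forall>w\<in>?D. fold apply_op ops1 \<sigma> (pos1 w) = v w"
    using compile_gate[of g D a pos] Cons.prems(1) a by auto
  have disj: "pos1 ` ?D \<inter> ?B = {}"
    using 1(3) Cons.prems(2) A by blast
  have ev: "evaluable ?D gs" using Cons.prems(1) by simp
  obtain ops2 pos2 where 2: "length ops2 \<le> length gs"
    "\<forall>(h, i, j, k)\<in>set ops2. {i, j} \<subseteq> pos1 ` ?D \<union> ?B \<and> k \<in> ?B \<and> k \<noteq> i \<and> k \<noteq> j"
    "pos2 ` (?D \<union> wires_out (set gs)) \<subseteq> pos1 ` ?D \<union> ?B"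
    "\<forall>\<sigma> v. (\<forall>p\<in>?B. \<not> \<sigma> p) \<and> (\<forall>g\<in>set gs. gate_holds v g) \<and>
       (\<forall>w\<in>?D. \<sigma> (pos1 w) = v w) \<longrightarrow>
       (\<forall>w\<in>?D \<union> wires_out (set gs). fold apply_op ops2 \<sigma> (pos2 w) = v w)"
    using Cons.IH[OF ev disj] by (elim exE conjE) (rule that)
  have out: "D \<union> wires_out (set (g # gs)) = ?D \<union> wires_out (set gs)"
    by (auto simp: wires_out_def)
  have sub: "pos1 ` ?D \<union> ?B \<subseteq> pos ` D \<union> ?A"
    using 1(3) A(1) by blast
  have ops: "\<forall>(h, i, j, k)\<in>set (ops1 @ ops2). {i, j} \<subseteq> pos ` D \<union> ?A \<and> k \<in> ?A \<and> k \<noteq> i \<and> k \<noteq> j"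
  proof (intro ballI, clarify)
    fix h i j k assume "(h, i, j, k) \<in> set (ops1 @ ops2)"
    then consider (fst) "(h, i, j, k) \<in> set ops1" | (snd) "(h, i, j, k) \<in> set ops2" by auto
    then show "{i, j} \<subseteq> pos ` D \<union> ?A \<and> k \<in> ?A \<and> k \<noteq> i \<and> k \<noteq> j"
    proof cases
      case fst
      then have "i \<in> pos ` D" "j \<in> pos ` D" "k = a" using 1(2) by auto
      then show ?thesis using a A(1) by auto
    next
      case snd
      then have "{i, j} \<subseteq> pos1 ` ?D \<union> ?B" "k \<in> ?B" "k \<noteq> i" "k \<noteq> j" using 2(2) by fast+
      then show ?thesis using sub A(1) by blast
    qed
  qed
  have sem: "\<forall>w\<in>?D \<union> wires_out (set gs). fold apply_op (ops1 @ ops2) \<sigma> (pos2 w) = v w"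
    if \<sigma>: "\<forall>p\<in>?A. \<not> \<sigma> p" "\<forall>g\<in>set (g # gs). gate_holds v g" "\<forall>w\<in>D. \<sigma> (pos w) = v w" for \<sigma> v
  proof -
    \<comment> \<open>The first gate writes to \<open>a\<close> only, so the scratch cells of the
      later gates are still zero.\<close>
    have "fold apply_op ops1 \<sigma> p = \<sigma> p" if "p \<in> ?B" for p
      using 1(2) that A(2) by (intro fold_apply_op_untouched) fast
    then have "\<forall>p\<in>?B. \<not> fold apply_op ops1 \<sigma> p"
      using \<sigma>(1) A(1) by blast
    moreover have "\<forall>w\<in>?D. fold apply_op ops1 \<sigma> (pos1 w) = v w"
      using 1(4) \<sigma> A(1) by auto
    ultimately show ?thesis
      using 2(4)[THEN spec, THEN spec, THEN mp, of "fold apply_op ops1 \<sigma>" v] \<sigma>(2) by simp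
  qed
  show ?case
    unfolding out
  proof (intro exI conjI)
    show "length (ops1 @ ops2) \<le> length (g # gs)" using 1(1) 2(1) by simp
    show "pos2 ` (?D \<union> wires_out (set gs)) \<subseteq> pos ` D \<union> ?A" using 2(3) sub by (rule subset_trans)
  qed (use ops sem in blast)+
qed

text \<open>Cells: 0 is spare, then come one scratch cell per gate, the \<open>n\<close> output cells,
  and the \<open>m\<close> input cells.\<close>

lemma circuit_program:
  assumes "computes C m n f"
  shows "\<exists>g ops. g \<le> length (gates C) \<and> length ops \<le> 2 * g + n \<and>
    (\<forall>p\<in>set ops. valid_op (1 + g + n + m) p) \<and>
    (\<forall>x. length x = m \<longrightarrow>
      map (fold apply_op ops (nth (replicate (1 + g + n) False @ x))) [0..<1 + g + n + m] =
        replicate (1 + g) False @ f x @ x)"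
proof -
  let ?G = "set (gates C)" and ?D = "set (in_wires C)"
  have wf: "well_formed C" and in_len: "length (in_wires C) = m" and out_len: "length (out_wires C) = n"
    and sem: "\<And>x. length x = m \<Longrightarrow> \<exists>v. (\<forall>g\<in>?G. gate_holds v g) \<and>
      map v (in_wires C) = x \<and> map v (out_wires C) = f x"
    using assms by (auto simp: computes_def)
  let ?r = "{(a, b). \<exists>g\<in>?G. a \<in> set (gate_ins g) \<and> b \<in> set (gate_outs g)}"
  have "?r \<subseteq> (\<Union>g\<in>?G. set (gate_ins g) \<times> set (gate_outs g))" by auto
  then have "finite ?r" by (rule finite_subset) simp
  then have "wf ?r"
    using wf by (intro finite_acyclic_wf) (simp_all add: well_formed_def)
  moreover have sinks: "set (circuit_sinks C) \<subseteq> ?D \<union> wires_out ?G"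
    using wf by (simp add: well_formed_def circuit_sources_def wires_out_def)
  then have "\<forall>g\<in>?G. set (gate_ins g) \<subseteq> ?D \<union> wires_out ?G"
    by (auto simp: circuit_sinks_def)
  ultimately obtain gs where gs: "set gs = ?G" "length gs = card ?G" "evaluable ?D gs"
    using evaluable_order[of ?G ?D] by blast
  \<comment> \<open>\<open>g\<close> counts the gates as a set, with one scratch cell for each; it
    is at most \<open>length (gates C)\<close>.\<close>
  define g where "g = length gs"
  define L where "L = 1 + g + n + m"
  have "\<forall>w\<in>?D. \<exists>q<m. in_wires C ! q = w"
    using in_len by (auto simp: in_set_conv_nth)
  then obtain idx where idx: "\<And>w. w \<in> ?D \<Longrightarrow> idx w < m" "\<And>w. w \<in> ?D \<Longrightarrow> in_wires C ! idx w = w"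
    by metis
  \<comment> \<open>The input block starts after cell 0, the \<open>g\<close> scratch cells and the
    \<open>n\<close> output cells.\<close>
  define pos where "pos w = 1 + g + n + idx w" for w
  let ?A = "{1..<1 + length gs}" and ?Y = "{1 + g..<1 + g + n}"
  have pos: "pos ` ?D \<subseteq> {1 + g + n..<L}"
    using idx by (auto simp: pos_def L_def)
  then have disj: "pos ` ?D \<inter> ?A = {}"
    by (auto simp: g_def)
  have cells: "pos ` ?D \<union> ?A \<subseteq> {0<..<L} - ?Y"
    using pos by (auto simp: g_def L_def)
  obtain ops pos' where ops: "length ops \<le> length gs"
    "\<forall>(h, i, j, k)\<in>set ops. {i, j} \<subseteq> pos ` ?D \<union> ?A \<and> k \<in> ?A \<and> k \<noteq> i \<and> k \<noteq> j"
    "pos' ` (?D \<union> wires_out (set gs)) \<subseteq> pos ` ?D \<union> ?A"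
    "\<forall>\<sigma> v. (\<forall>p\<in>?A. \<not> \<sigma> p) \<and> (\<forall>g\<in>set gs. gate_holds v g) \<and>
       (\<forall>w\<in>?D. \<sigma> (pos w) = v w) \<longrightarrow>
       (\<forall>w\<in>?D \<union> wires_out (set gs). fold apply_op ops \<sigma> (pos' w) = v w)"
    using compile_gates[OF gs(3) disj] by (elim exE conjE) (rule that)
  have inside: "{i, j, k} \<subseteq> {0<..<L} - ?Y \<and> k \<noteq> i \<and> k \<noteq> j"
    if "(h, i, j, k) \<in> set ops" for h i j k
  proof -
    have *: "{i, j} \<subseteq> pos ` ?D \<union> ?A \<and> k \<in> ?A \<and> k \<noteq> i \<and> k \<noteq> j"
      using bspec[OF ops(2) that] unfolding prod.case .
    then have "{i, j, k} \<subseteq> pos ` ?D \<union> ?A" by blast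
    then show ?thesis using cells * by (meson subset_trans)
  qed
  have off_target: "\<forall>(h, i, j, k)\<in>set ops. k \<noteq> i \<and> k \<noteq> j"
    using inside by blast
  have off_Y: "\<forall>(h, i, j, k)\<in>set ops. {i, j, k} \<inter> ?Y = {}"
    using inside by blast
  define src where "src q = pos' (out_wires C ! q)" for q
  have out: "out_wires C ! q \<in> ?D \<union> wires_out (set gs)" if "q < n" for q
  proof -
    have "out_wires C ! q \<in> set (circuit_sinks C)"
      using that out_len by (simp add: circuit_sinks_def)
    then show ?thesis unfolding gs(1) using sinks by (rule rev_subsetD)
  qed
  have src: "src q \<in> {0<..<L} - ?Y" if "q < n" for q
    using out[OF that] ops(3) cells unfolding src_def by blast
  define copy :: "xor_op list" where
    "copy = map (\<lambda>q. (\<lambda>b _. b, src q, src q, 1 + g + q)) [0..<n]"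
  \<comment> \<open>Compute, copy, uncompute; \<open>fold\<close> runs the list from left to
    right.\<close>
  let ?P = "ops @ copy @ rev ops"
  have valid: "valid_op L p" if p: "p \<in> set ?P" for p
  proof -
    consider "p \<in> set ops" | q where "q < n" "p = (\<lambda>b _. b, src q, src q, 1 + g + q)"
      using p by (auto simp: copy_def)
    then show ?thesis
    proof cases
      case 1
      obtain h i j k where "p = (h, i, j, k)" by (cases p)
      then show ?thesis using inside[of h i j k] 1 by (auto simp: valid_op_def)
    next
      case 2
      then show ?thesis using src[of q] by (auto simp: valid_op_def L_def)
    qed
  qed
  have len: "length ?P \<le> 2 * g + n"
    using ops(1) by (simp add: copy_def g_def)
  have g_le: "g \<le> length (gates C)"
    using gs(2) card_length[of "gates C"] by (simp add: g_def)
  have run: "map (fold apply_op ?P (nth (replicate (1 + g + n) False @ x))) [0..<L] =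
      replicate (1 + g) False @ f x @ x" if x: "length x = m" for x
  proof -
    obtain v where v: "\<forall>g\<in>?G. gate_holds v g" "map v (in_wires C) = x" "map v (out_wires C) = f x"
      using sem[OF x] by blast
    have fx: "length (f x) = n" using v(3) out_len by (metis length_map)
    define \<sigma> where "\<sigma> = nth (replicate (1 + g + n) False @ x)"
    define \<tau> where "\<tau> p = f x ! (p - (1 + g))" for p
    have zero: "\<not> \<sigma> p" if "p < 1 + g + n" for p
      using that by (simp add: \<sigma>_def nth_append del: replicate_Suc)
    have "\<sigma> (pos w) = v w" if "w \<in> ?D" for w
    proof -
      have "\<sigma> (pos w) = x ! idx w"
        by (simp add: \<sigma>_def pos_def nth_append del: replicate_Suc)
      also have "\<dots> = v w" using idx[OF that] in_len v(2) by (metis nth_map)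
      finally show ?thesis .
    qed
    then have val: "fold apply_op ops \<sigma> (pos' w) = v w" if "w \<in> ?D \<union> wires_out (set gs)" for w
      using ops(4)[THEN spec, THEN spec, THEN mp, of \<sigma> v] v(1) gs(1) zero that by (auto simp: g_def)
    have src_val: "fold apply_op ops \<sigma> (src q) = f x ! q" if "q < n" for q
      using val[OF out[OF that]] v(3) out_len that by (metis src_def nth_map)
    have out_zero: "\<not> fold apply_op ops \<sigma> p" if "p \<in> ?Y" for p
    proof -
      have "fold apply_op ops \<sigma> p = \<sigma> p"
      proof (rule fold_apply_op_untouched, clarify)
        fix h i j assume "(h, i, j, p) \<in> set ops"
        then show False using inside[of h i j p] that by simp
      qed
      then show ?thesis using zero[of p] that by simp
    qed
    have "fold apply_op copy (fold apply_op ops \<sigma>) =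
        override_on (fold apply_op ops \<sigma>) (\<lambda>p. fold apply_op ops \<sigma> p \<noteq> fold apply_op ops \<sigma> (src (p - (1 + g)))) ?Y"
      unfolding copy_def by (rule fold_copy_ops) (use src in simp)
    \<comment> \<open>The output cells are still zero after the computation, so xoring a source into
      them amounts to copying it.\<close>
    also have "\<dots> = override_on (fold apply_op ops \<sigma>) \<tau> ?Y"
    proof
      fix p
      show "override_on (fold apply_op ops \<sigma>) (\<lambda>p. fold apply_op ops \<sigma> p \<noteq> fold apply_op ops \<sigma> (src (p - (1 + g)))) ?Y p =
          override_on (fold apply_op ops \<sigma>) \<tau> ?Y p"
      proof (cases "p \<in> ?Y")
        case True
        then have "p - (1 + g) < n" by auto
        then show ?thesis using True out_zero[OF True] src_val by (simp add: override_on_def \<tau>_def)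
      next
        case False
        show ?thesis unfolding override_on_apply_notin[OF False] ..
      qed
    qed
    \<comment> \<open>Writing the output is moved before the computation, so that \<open>ops\<close>
      stands next to \<open>rev ops\<close> and cancels.\<close>
    also have "\<dots> = fold apply_op ops (override_on \<sigma> \<tau> ?Y)"
      by (rule fold_apply_op_override_on[OF off_Y, symmetric])
    finally have "fold apply_op ?P \<sigma> = override_on \<sigma> \<tau> ?Y"
      using fold_apply_op_rev[OF off_target] by simp
    moreover have "map (override_on \<sigma> \<tau> ?Y) [0..<L] = replicate (1 + g) False @ f x @ x"
      by (rule nth_equalityI)
        (auto simp: L_def fx x \<sigma>_def \<tau>_def override_on_def nth_append not_less simp del: replicate_Suc upt_Suc)
    ultimately show ?thesis by (simp only: \<sigma>_def)
  qed
  show ?thesis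
    using valid len g_le run unfolding L_def by (intro exI[of _ g] exI[of _ ?P] conjI ballI allI impI)
qed

section \<open>Padding with zeros\<close>

text \<open>The padding element maps the prefix code 0, 10, 11 onto the prefix code 00, 01, 1.
  \<open>X\<close> represents it and \<open>Y\<close> its inverse.\<close>

lemma zero_padding_words:
  assumes "\<Gamma> \<subseteq> carrier G21" "generate G21 \<Gamma> = carrier G21"
  obtains X Y where
    "\<forall>l\<in>set (X @ Y). letter_over \<Gamma> l" "\<forall>i. Tau i \<notin> set (X @ Y)"
    "\<And>w. word_val X (False # w) = Some (False # False # w)"
    "\<And>w. word_val Y (False # False # w) = Some (False # w)"
proof -
  define \<phi> :: "bits \<rightharpoonup> bits" where
    "\<phi> s = (case s of False # w \<Rightarrow> Some (False # False # w)
      | True # False # w \<Rightarrow> Some (False # True # w)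
      | True # True # w \<Rightarrow> Some (True # w) | _ \<Rightarrow> None)" for s
  have \<phi>: "\<phi> (False # w) = Some (False # False # w)" "\<phi> (True # False # w) = Some (False # True # w)"
    "\<phi> (True # True # w) = Some (True # w)" "\<phi> [] = None" "\<phi> [True] = None" for w
    by (simp_all add: \<phi>_def)
  \<comment> \<open>The three code words, together with the two strings too short to begin with any
    of them.\<close>
  have cases: thesis
    if "\<And>w. s = False # w \<Longrightarrow> thesis" "\<And>w. s = True # False # w \<Longrightarrow> thesis"
      "\<And>w. s = True # True # w \<Longrightarrow> thesis" "s = [] \<Longrightarrow> thesis" "s = [True] \<Longrightarrow> thesis" for s thesis
    using that by (metis (full_types) list.exhaust)
  have iso: "cofinite_iso \<phi>"
  proof (rule cofinite_isoI[of _ 2])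
    show "\<phi> (r @ z) = Some (t @ z)" if "\<phi> r = Some t" for r t z
      using that by (cases r rule: cases) (auto simp: \<phi>)
    show "r = s" if "\<phi> r = Some t" "\<phi> s = Some t" for r s t
      using that by (cases r rule: cases; cases s rule: cases) (auto simp: \<phi>)
    show "\<exists>t. \<phi> s = Some t" if "2 \<le> length s" for s
      using that by (cases s rule: cases) (auto simp: \<phi>)
    show "\<exists>r. \<phi> r = Some s" if s: "2 \<le> length s" for s
    proof -
      obtain a b w where "s = a # b # w"
        using s by (auto simp: numeral_2_eq_2 Suc_le_length_iff)
      \<comment> \<open>The image code word 1 is a single bit, so in the third clause
        \<open>b\<close> belongs to the tail.\<close>
      then show ?thesis using \<phi>(1)[of w] \<phi>(2)[of w] \<phi>(3)[of "b # w"] by (cases a; cases b) auto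
    qed
  qed
  obtain \<psi> where \<psi>: "cofinite_iso \<psi>" "\<And>s t. \<psi> t = Some s \<longleftrightarrow> \<phi> s = Some t"
    using cofinite_iso_inverse[OF iso] by blast
  obtain X where X: "\<forall>l\<in>set X. letter_over \<Gamma> l" "\<forall>i. Tau i \<notin> set X"
    "\<forall>s t. \<phi> s = Some t \<longrightarrow> word_val X s = Some t"
    using word_of_iso[OF assms iso] by blast
  obtain Y where Y: "\<forall>l\<in>set Y. letter_over \<Gamma> l" "\<forall>i. Tau i \<notin> set Y"
    "\<forall>s t. \<psi> s = Some t \<longrightarrow> word_val Y s = Some t"
    using word_of_iso[OF assms \<psi>(1)] by blast
  show ?thesis
    by (rule that[of X Y]) (use X Y \<phi>(1) \<psi>(2) in auto)
qed

lemma word_val_power_pad: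
  assumes "\<Gamma> \<subseteq> carrier G21" "\<forall>l\<in>set X. letter_over \<Gamma> l"
    and "\<And>w. word_val X (False # w) = Some (False # False # w)"
  shows "word_val (concat (replicate k X)) (False # w) = Some (replicate (Suc k) False @ w)"
proof (induction k)
  case (Suc k)
  have over: "\<forall>l\<in>set (X @ concat (replicate k X)). letter_over \<Gamma> l"
    using assms(2) by auto
  show ?case
    using word_val_append_Some[OF assms(1) over Suc, of "replicate (Suc (Suc k)) False @ w"] assms(3)
    by simp
qed (simp add: one_G21)

lemma word_val_power_unpad:
  assumes "\<Gamma> \<subseteq> carrier G21" "\<forall>l\<in>set Y. letter_over \<Gamma> l"
    and "\<And>w. word_val Y (False # False # w) = Some (False # w)"
  shows "word_val (concat (replicate k Y)) (replicate (Suc k) False @ w) = Some (False # w)"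
proof (induction k arbitrary: w)
  case (Suc k)
  have over: "\<forall>l\<in>set (Y @ concat (replicate k Y)). letter_over \<Gamma> l"
    using assms(2) by auto
  \<comment> \<open>One zero is counted as part of the tail, so the induction hypothesis leaves two
    zeros and the leftmost \<open>Y\<close> deletes one of them.\<close>
  have eq: "replicate (Suc (Suc k)) False @ w = replicate (Suc k) False @ False # w"
    by (simp add: replicate_app_Cons_same)
  show ?case
    unfolding eq
    using word_val_append_Some[OF assms(1) over Suc[of "False # w"] assms(3)] by simp
qed (simp add: one_G21)

section \<open>Counting letters and assembling the word\<close>

lemma length_bound:
  fixes g n m S a b K :: nat
  assumes "g + n + m \<le> S"
  shows "a * (g + n) + (2 * g + n) * (K + 12 * (1 + g + n + m)) + b * g
    \<le> (a + b + 2 * K + 48) * S ^ 4"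
proof (cases "S = 0")
  case False
  have S: "S \<le> S ^ 4" "S * S \<le> S ^ 4"
    using False power_increasing[of 1 4 S] power_increasing[of 2 4 S] by (simp_all add: power2_eq_square)
  have "a * (g + n) \<le> a * S ^ 4" "b * g \<le> b * S ^ 4"
    using assms S(1) by (intro mult_left_mono; linarith)+
  \<comment> \<open>Since \<open>S\<close> is positive, \<open>1 + g + n + m\<close> is at most
    \<open>2 * S\<close>. The program length is thus quadratic in \<open>S\<close>, and only
    afterwards weakened to the fourth power.\<close>
  moreover have "(2 * g + n) * (K + 12 * (1 + g + n + m)) \<le> (2 * S) * (K + 24 * S)"
    using assms False by (intro mult_mono) auto
  moreover have "(2 * S) * (K + 24 * S) = 2 * K * S + 48 * (S * S)"
    by (simp add: algebra_simps)
  moreover have "2 * K * S + 48 * (S * S) \<le> 2 * K * S ^ 4 + 48 * S ^ 4"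
    using S by (intro add_mono mult_left_mono) auto
  moreover have "(a + b + 2 * K + 48) * S ^ 4 = a * S ^ 4 + b * S ^ 4 + (2 * K * S ^ 4 + 48 * S ^ 4)"
    by (simp add: algebra_simps)
  ultimately show ?thesis by linarith
qed (use assms in simp)

theorem theorem4p1:
  fixes \<Gamma> :: "(bits \<rightharpoonup> bits) set"
  assumes "finite \<Gamma>" and "\<Gamma> \<subseteq> carrier G21" and "generate G21 \<Gamma> = carrier G21"
  shows "\<exists>c::nat. \<forall>(m::nat) (n::nat) (f :: bits \<Rightarrow> bits) C.
           (\<forall>x. length x = m \<longrightarrow> length (f x) = n) \<and> min_circuit C m n f \<longrightarrow>
           (\<exists>W. (\<forall>l\<in>set W. letter_over \<Gamma> l) \<and>
                (\<forall>x. length x = m \<longrightarrow> word_val W (False # x) = Some (False # f x @ x)) \<and>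
                length W \<le> c * circuit_size C ^ 4 \<and>
                (\<forall>i. Tau i \<in> set W \<longrightarrow> i + 1 \<le> circuit_size C ^ 2 + 2))"
proof -
  note \<Gamma> = assms(2)
  obtain X Y where XY: "\<forall>l\<in>set (X @ Y). letter_over \<Gamma> l" "\<forall>i. Tau i \<notin> set (X @ Y)"
    "\<And>w. word_val X (False # w) = Some (False # False # w)"
    "\<And>w. word_val Y (False # False # w) = Some (False # w)"
    using zero_padding_words[OF assms(2,3)] by blast
  obtain K where K: "\<And>L h. 3 \<le> L \<Longrightarrow> implementable \<Gamma> L K (apply_op (h, 0, 1, 2))"
    using implementable_front_op[OF assms(2,3)] by blast
  have "\<exists>W. (\<forall>l\<in>set W. letter_over \<Gamma> l) \<and>
      (\<forall>x. length x = m \<longrightarrow> word_val W (False # x) = Some (False # f x @ x)) \<and>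
      length W \<le> (length X + length Y + 2 * K + 48) * circuit_size C ^ 4 \<and>
      (\<forall>i. Tau i \<in> set W \<longrightarrow> i + 1 \<le> circuit_size C ^ 2 + 2)"
    if "min_circuit C m n f" for m n f C
  proof -
    have comp: "computes C m n f" using that by (simp add: min_circuit_def)
    then obtain g ops where P: "g \<le> length (gates C)" "length ops \<le> 2 * g + n"
      "\<forall>p\<in>set ops. valid_op (1 + g + n + m) p"
      "\<And>x. length x = m \<Longrightarrow>
        map (fold apply_op ops (nth (replicate (1 + g + n) False @ x))) [0..<1 + g + n + m] =
          replicate (1 + g) False @ f x @ x"
      using circuit_program[OF comp] by blast
    let ?L = "1 + g + n + m" and ?S = "circuit_size C"
    have S: "g + n + m \<le> ?S"
      using comp P(1) by (simp add: computes_def circuit_size_def)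
    obtain V where V: "\<forall>l\<in>set V. letter_over \<Gamma> l" "\<forall>i. Tau i \<in> set V \<longrightarrow> i + 1 \<le> ?L"
      "length V \<le> length ops * (K + 12 * ?L)"
      "\<And>\<sigma>. word_val V (map \<sigma> [0..<?L]) = Some (map (fold apply_op ops \<sigma>) [0..<?L])"
      using implementable_program[OF \<Gamma> K P(3)] unfolding implementable_def by blast
    \<comment> \<open>Behind the leading zero, \<open>g + n\<close> zeros are created but only
      \<open>g\<close> deleted: the other \<open>n\<close> cells now hold the output.\<close>
    let ?X = "concat (replicate (g + n) X)" and ?Y = "concat (replicate g Y)"
    let ?W = "?Y @ V @ ?X"
    have over: "\<forall>l\<in>set (V @ ?X). letter_over \<Gamma> l" "\<forall>l\<in>set ?W. letter_over \<Gamma> l"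
      using XY(1) V(1) by auto
    have "word_val ?W (False # x) = Some (False # f x @ x)" if x: "length x = m" for x
    proof -
      let ?s = "replicate (1 + g + n) False @ x"
      have "word_val ?X (False # x) = Some ?s"
        using word_val_power_pad[OF \<Gamma>, of X] XY(1,3) by simp
      moreover have "word_val V ?s = Some (replicate (1 + g) False @ f x @ x)"
      proof -
        have "map (nth ?s) [0..<?L] = ?s"
          using map_nth[of ?s] x by simp
        then show ?thesis using V(4)[of "nth ?s"] P(4)[OF x] by (simp only:)
      qed
      moreover have "word_val ?Y (replicate (1 + g) False @ f x @ x) = Some (False # f x @ x)"
        using word_val_power_unpad[OF \<Gamma>, of Y g "f x @ x"] XY(1,4) by simp
      ultimately show ?thesis
        using word_val_append_Some[OF \<Gamma> over(2)] word_val_append_Some[OF \<Gamma> over(1)] by blast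
    qed
    moreover have "length ?W \<le> (length X + length Y + 2 * K + 48) * ?S ^ 4"
    proof -
      have "length V \<le> (2 * g + n) * (K + 12 * ?L)"
        using V(3) P(2) by (meson le_trans mult_le_mono1)
      then show ?thesis
        using length_bound[OF S, of "length X" K "length Y"]
        by (simp add: length_concat sum_list_replicate mult.commute)
    qed
    moreover have "i + 1 \<le> ?S ^ 2 + 2" if "Tau i \<in> set ?W" for i
    proof -
      \<comment> \<open>Transposition letters come from \<open>V\<close> alone, and the string it
        acts on has length at most \<open>?S + 1\<close>.\<close>
      have "i + 1 \<le> ?L" using that XY(2) V(2) by auto
      moreover have "?S \<le> ?S ^ 2" by (simp add: power2_eq_square)
      ultimately show ?thesis using S by linarith
    qed
    ultimately show ?thesis using over(2) by blast
  qed
  then show ?thesis by blast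
qed

end
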